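(* Let $n\geq 2.16\times 10^{17}$ be an integer. Then the $n$-vertex graph $K_2+H(3,1)$, where $H(3,1)=P_3\cup (n-5)K_1$, is, up to isomorphism, the unique extremal graph to $\mathrm{spex}_{\mathcal{P}}(n,2\mathcal{C})$; that is, it is the unique graph of maximum spectral radius among all $n$-vertex planar graphs that do not contain two vertex-disjoint cycles.
   Context: All graphs are finite and simple. The spectral radius of a graph is that of its adjacency matrix. $2\mathcal{C}$ denotes the family of all graphs that are the disjoint union of two cycles (of arbitrary, possibly different, lengths); a graph is $2\mathcal{C}$-free if it contains no member of this family as a subgraph, i.e. it has no two vertex-disjoint cycles. $\mathrm{spex}_{\mathcal{P}}(n,2\mathcal{C})$ is the maximum spectral radius over all $n$-vertex $2\mathcal{C}$-free planar graphs, and an extremal graph is one attaining it. $G+H$ denotes the join of $G$ and $H$, $P_3$ is the path on 3 vertices, and $mK_1$ is the graph of $m$ isolated vertices. *)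

theory Defs
  imports
    "HOL-Analysis.Analysis"
    "Jordan_Normal_Form.Spectral_Radius"
    "Graph_Theory.Graph_Theory"
begin

text \<open>
  A finite simple graph is a \<^locale>\<open>pair_graph\<close>: a finite, loop-free digraph whose arcs form a
  symmetric set of ordered pairs, every undirected edge being represented by its two orientations.
\<close>

definition edges :: "'a pair_pre_digraph \<Rightarrow> 'a set set" where
  "edges G = (\<lambda>(u, v). {u, v}) ` parcs G"

definition graph_iso :: "'a pair_pre_digraph \<Rightarrow> 'b pair_pre_digraph \<Rightarrow> bool" where
  "graph_iso G H \<longleftrightarrow> digraph_iso (with_proj G) (with_proj H)"

definition contains_copy :: "'a pair_pre_digraph \<Rightarrow> 'b pair_pre_digraph \<Rightarrow> bool" where
  "contains_copy G F \<longleftrightarrow>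
    (\<exists>H. pair_graph H \<and> subgraph (with_proj H) (with_proj G) \<and> graph_iso H F)"

definition family_free :: "'b pair_pre_digraph set \<Rightarrow> 'a pair_pre_digraph \<Rightarrow> bool" where
  "family_free \<F> G \<longleftrightarrow> (\<forall>F\<in>\<F>. \<not> contains_copy G F)"

definition complete_graph :: "nat \<Rightarrow> nat pair_pre_digraph" where
  "complete_graph k = \<lparr>pverts = {..<k}, parcs = {(i, j). i < k \<and> j < k \<and> i \<noteq> j}\<rparr>"

definition empty_graph :: "nat \<Rightarrow> nat pair_pre_digraph" where
  "empty_graph k = \<lparr>pverts = {..<k}, parcs = {}\<rparr>"

definition path_graph :: "nat \<Rightarrow> nat pair_pre_digraph" where
  "path_graph k =
    \<lparr>pverts = {..<k}, parcs = {(i, j). i < k \<and> j < k \<and> (j = Suc i \<or> i = Suc j)}\<rparr>"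

text \<open>A simple graph, and a cycle, only for \<open>k \<ge> 3\<close>.\<close>

definition cycle_graph :: "nat \<Rightarrow> nat pair_pre_digraph" where
  "cycle_graph k =
    \<lparr>pverts = {..<k},
     parcs = {(i, j). i < k \<and> j < k \<and> (j = Suc i mod k \<or> i = Suc j mod k)}\<rparr>"

definition disjoint_union ::
    "'a pair_pre_digraph \<Rightarrow> 'b pair_pre_digraph \<Rightarrow> ('a + 'b) pair_pre_digraph" where
  "disjoint_union G H =
    \<lparr>pverts = pverts G <+> pverts H,
     parcs = map_prod Inl Inl ` parcs G \<union> map_prod Inr Inr ` parcs H\<rparr>"

definition graph_join ::
    "'a pair_pre_digraph \<Rightarrow> 'b pair_pre_digraph \<Rightarrow> ('a + 'b) pair_pre_digraph" where
  "graph_join G H =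
    \<lparr>pverts = pverts G <+> pverts H,
     parcs = map_prod Inl Inl ` parcs G \<union> map_prod Inr Inr ` parcs H
       \<union> (Inl ` pverts G) \<times> (Inr ` pverts H) \<union> (Inr ` pverts H) \<times> (Inl ` pverts G)\<rparr>"

definition two_cycles :: "(nat + nat) pair_pre_digraph set" where
  "two_cycles = {disjoint_union (cycle_graph k) (cycle_graph l) | k l. k \<ge> 3 \<and> l \<ge> 3}"

text \<open>
  Planar drawings: vertices are distinct points of the plane (here \<^typ>\<open>complex\<close>), every edge is a
  simple arc joining its two end vertices and meeting no other vertex, and two different edges
  meet at most in common end vertices.
\<close>

definition planar_drawing ::
    "'a pair_pre_digraph \<Rightarrow> ('a \<Rightarrow> complex) \<Rightarrow> ('a set \<Rightarrow> real \<Rightarrow> complex) \<Rightarrow> bool" where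
  "planar_drawing G p \<gamma> \<longleftrightarrow>
    inj_on p (pverts G) \<and>
    (\<forall>e\<in>edges G. arc (\<gamma> e) \<and> {pathstart (\<gamma> e), pathfinish (\<gamma> e)} = p ` e \<and>
       path_image (\<gamma> e) \<inter> p ` pverts G = p ` e) \<and>
    (\<forall>e\<in>edges G. \<forall>e'\<in>edges G. e \<noteq> e' \<longrightarrow>
       path_image (\<gamma> e) \<inter> path_image (\<gamma> e') \<subseteq> p ` (e \<inter> e'))"

definition planar :: "'a pair_pre_digraph \<Rightarrow> bool" where
  "planar G \<longleftrightarrow> (\<exists>p \<gamma>. planar_drawing G p \<gamma>)"

definition adjacency_matrix :: "'a pair_pre_digraph \<Rightarrow> 'a list \<Rightarrow> complex mat" where
  "adjacency_matrix G vs =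
    Matrix.mat (length vs) (length vs) (\<lambda>(i, j). if (vs ! i, vs ! j) \<in> parcs G then 1 else 0)"

text \<open>
  Different vertex orderings give permutation-similar adjacency matrices, so the choice of the
  ordering is immaterial.
\<close>

definition graph_spectral_radius :: "'a pair_pre_digraph \<Rightarrow> real" where
  "graph_spectral_radius G =
    spectral_radius (adjacency_matrix G (SOME vs. distinct vs \<and> set vs = pverts G))"

definition planar_free_graph ::
    "nat \<Rightarrow> 'b pair_pre_digraph set \<Rightarrow> 'a pair_pre_digraph \<Rightarrow> bool" where
  "planar_free_graph n \<F> G \<longleftrightarrow>
    pair_graph G \<and> card (pverts G) = n \<and> planar G \<and> family_free \<F> G"

text \<open>
  Every finite graph is isomorphic to one whose vertices are natural numbers, so it suffices to
  take the maximum over these; there are finitely many isomorphism classes of \<open>n\<close>-vertex graphs,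
  hence the set of values is finite.
\<close>

definition spex_planar :: "nat \<Rightarrow> 'b pair_pre_digraph set \<Rightarrow> real" where
  "spex_planar n \<F> =
    Max {graph_spectral_radius G | G :: nat pair_pre_digraph. planar_free_graph n \<F> G}"

definition extremal_planar ::
    "nat \<Rightarrow> 'b pair_pre_digraph set \<Rightarrow> 'a pair_pre_digraph \<Rightarrow> bool" where
  "extremal_planar n \<F> G \<longleftrightarrow>
    planar_free_graph n \<F> G \<and> graph_spectral_radius G = spex_planar n \<F>"

definition H31 :: "nat \<Rightarrow> (nat + nat) pair_pre_digraph" where
  "H31 n = disjoint_union (path_graph 3) (empty_graph (n - 5))"

end

theory Submission
  imports Defs
begin

text \<open>
  By compactness and symmetry the spectral radius is the maximum of the Rayleigh quotient, attained
  at a nonnegative eigenvector \<open>x\<close>, scaled to have maximum 1 at a vertex \<open>z\<close>. Planarity enters only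
  through the absence of \<open>K\<^sub>3\<^sub>,\<^sub>3\<close>. Disjoint cycles correspond to disjoint vertex
  sets of minimum degree two (cores). If \<open>G\<close> is at least as good as \<open>K\<^sub>2 + H(3,1)\<close>, it contains
  a 4-cycle, and removing it leaves a forest; hence \<open>G\<close> is sparse, and between a small set \<open>S\<close> and a
  set \<open>T\<close> there are at most \<open>2|T| + O(|S|)\<close> edges. Applied to the set of vertices with a large
  eigenvector entry, the equation \<open>A\<^sup>2x = \<rho>\<^sup>2x\<close> with \<open>\<rho>\<^sup>2 \<ge> 2n - 4\<close> yields a second vertex \<open>w\<close> such that \<open>z\<close>
  and \<open>w\<close> have almost all vertices as common neighbours, while all other entries of \<open>x\<close> are small.
  Joining the remaining vertices to both \<open>z\<close> and \<open>w\<close>, at the cost of their other edges, would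
  increase the Rayleigh quotient, so there are none, and what is left between the common neighbours
  is contained in a path with three vertices.
\<close>

section \<open>Spectral radius as maximal Rayleigh quotient\<close>

text \<open>Two features shape the argument. A competitor is not known to be connected, so its
  eigenvector is only nonnegative and entries may vanish. Strict positivity appears only at the very
  end: equality in the Rayleigh comparison makes \<open>x\<close> an eigenvector of the extremal
  graph too, and there every vertex other than \<open>z\<close> is adjacent to \<open>z\<close>. The
  factor 2 in front of |T| in the edge bound has to be exact. A vertex u uses up one of the two
  edges at each of its neighbours, so its codegrees with the other large vertices add up to little
  more than deg u. As 2n - 4, the squared spectral radius of K_{2,n-2}, is almost twice the largest
  possible degree, one of these vertices must have an entry close to 1. The errors are multiples of
  the number of large entries, which is at most 10^4 n / r and thus of order sqrt n; the size of n
  serves to push them below n/1000. Minimum degree two replaces cycles because it can be checked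
  vertex by vertex, and because a set without such a subset can be peeled one vertex at a time.
  Vertex and arc sets are kept apart from graph records so that two arc sets on the same vertices
  can be compared.\<close>

locale sgraph =
  fixes V :: "'a set" and E :: "('a \<times> 'a) set"
  assumes fin_V [simp]: "finite V"
    and E_sub: "E \<subseteq> V \<times> V"
    and E_sym: "(u, v) \<in> E \<Longrightarrow> (v, u) \<in> E"
    and E_irrefl [simp]: "(u, u) \<notin> E"
begin

lemma fin_E [simp]: "finite E"
  using E_sub by (rule finite_subset) simp

lemma E_V: "(u, v) \<in> E \<Longrightarrow> u \<in> V" "(u, v) \<in> E \<Longrightarrow> v \<in> V"
  using E_sub by auto

lemma nb_sub: "E `` S \<subseteq> V"
  using E_sub by auto

lemma fin_nb [simp]: "finite (E `` S)"
  using nb_sub by (rule finite_subset) simp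

text \<open>The quadratic form x^T A x. Both orientations of an edge lie in \<open>E\<close>, so
  every edge counts twice.\<close>

definition qf :: "('a \<Rightarrow> real) \<Rightarrow> real" where
  "qf x = (\<Sum>(u, v)\<in>E. x u * x v)"

definition sq :: "('a \<Rightarrow> real) \<Rightarrow> real" where
  "sq x = (\<Sum>v\<in>V. (x v)\<^sup>2)"

lemma sum_E: "(\<Sum>(u, v)\<in>E. f u v) = (\<Sum>u\<in>V. \<Sum>v\<in>E `` {u}. f u v)"
proof -
  have "E = Sigma V (\<lambda>u. E `` {u})"
    using E_sub by auto
  then have "(\<Sum>(u, v)\<in>E. f u v) = (\<Sum>(u, v)\<in>Sigma V (\<lambda>u. E `` {u}). f u v)"
    by (rule arg_cong)
  also have "\<dots> = (\<Sum>u\<in>V. \<Sum>v\<in>E `` {u}. f u v)"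
    by (rule sum.Sigma[symmetric]) auto
  finally show ?thesis .
qed

lemma qf_eq: "qf x = (\<Sum>u\<in>V. x u * (\<Sum>v\<in>E `` {u}. x v))"
  unfolding qf_def sum_E by (simp add: sum_distrib_left)

lemma sq_upd: "v \<in> V \<Longrightarrow> sq (x(v := x v + t)) = sq x + 2 * t * x v + t\<^sup>2"
proof -
  assume v: "v \<in> V"
  have "sq (x(v := x v + t)) = (x v + t)\<^sup>2 + (\<Sum>u\<in>V - {v}. (x u)\<^sup>2)"
    unfolding sq_def using v by (subst sum.remove[of V v]) (auto intro!: sum.cong)
  moreover have "sq x = (x v)\<^sup>2 + (\<Sum>u\<in>V - {v}. (x u)\<^sup>2)"
    unfolding sq_def using v by (subst sum.remove[of V v]) auto
  ultimately show ?thesis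
    by (simp add: power2_eq_square algebra_simps)
qed

lemma qf_upd: "v \<in> V \<Longrightarrow> qf (x(v := x v + t)) = qf x + 2 * t * (\<Sum>w\<in>E `` {v}. x w)"
proof -
  assume v: "v \<in> V"
  let ?d = "\<lambda>u. if u = v then t else 0"
  have eq: "x(v := x v + t) = (\<lambda>u. x u + ?d u)"
    by auto
  have 1: "(\<Sum>(a, b)\<in>E. ?d a * x b) = t * (\<Sum>w\<in>E `` {v}. x w)"
    unfolding sum_E sum_distrib_left[symmetric] using v
    by (simp add: if_distrib[of "\<lambda>c. c * _"] cong: if_cong)
  have 2: "(\<Sum>(a, b)\<in>E. x a * ?d b) = (\<Sum>(a, b)\<in>E. ?d a * x b)"
    by (rule sum.reindex_bij_witness[of _ prod.swap prod.swap]) (auto intro: E_sym)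
  have 3: "(\<Sum>(a, b)\<in>E. ?d a * ?d b) = 0"
    by (intro sum.neutral) auto
  have "qf (x(v := x v + t)) = (\<Sum>(a, b)\<in>E. x a * x b + ?d a * x b + x a * ?d b + ?d a * ?d b)"
    unfolding qf_def eq by (intro sum.cong refl) (auto simp: algebra_simps)
  also have "\<dots> = qf x + (\<Sum>(a, b)\<in>E. ?d a * x b) + (\<Sum>(a, b)\<in>E. x a * ?d b)
      + (\<Sum>(a, b)\<in>E. ?d a * ?d b)"
    unfolding qf_def by (simp add: sum.distrib split_def)
  also have "\<dots> = qf x + 2 * t * (\<Sum>w\<in>E `` {v}. x w)"
    unfolding 2 3 1 by simp
  finally show ?thesis .
qed

text \<open>First-order condition in a single coordinate: changing \<open>x v\<close> by
  \<open>t\<close> changes \<open>qf x - l * sq x\<close> by \<open>2 * t * c - l * t^2\<close>,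
  where \<open>c\<close> is the defect of the eigenvalue equation at \<open>v\<close>. This is never
  positive, which forces \<open>c = 0\<close>. It is used for the competitor and, at the end, for
  the extremal graph.\<close>

lemma rayleigh_equality:
  assumes max: "\<And>y. qf y \<le> l * sq y" and eq: "qf x = l * sq x" and v: "v \<in> V"
  shows "(\<Sum>w\<in>E `` {v}. x w) = l * x v"
proof -
  define c where "c = (\<Sum>w\<in>E `` {v}. x w) - l * x v"
  have key: "2 * t * c \<le> l * t\<^sup>2" for t
    using max[of "x(v := x v + t)"] unfolding sq_upd[OF v] qf_upd[OF v]
    using eq by (simp add: c_def algebra_simps)
  have l: "l \<ge> 0"
    using key[of 1] key[of "-1"] by simp
  \<comment> \<open>The denominator stays positive for \<open>l = 0\<close>, the edgeless case; with
    this increment the inequality already fails unless \<open>c = 0\<close>.\<close>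
  define s where "s = c / (l + 1)"
  have cs: "c = s * (l + 1)"
    using l by (simp add: s_def)
  have "2 * s * c \<le> l * s\<^sup>2"
    by (rule key)
  then have "(l + 2) * s\<^sup>2 \<le> 0"
    unfolding cs by (simp add: algebra_simps power2_eq_square)
  then have "s\<^sup>2 \<le> 0"
    using l by (auto simp: mult_le_0_iff)
  then have "c = 0"
    using cs by simp
  then show ?thesis
    by (simp add: c_def)
qed

lemma qf_cong: "(\<And>v. v \<in> V \<Longrightarrow> x v = y v) \<Longrightarrow> qf x = qf y"
  unfolding qf_eq using nb_sub by (intro sum.cong arg_cong2[where f = "(*)"]) auto

lemma sq_cong: "(\<And>v. v \<in> V \<Longrightarrow> x v = y v) \<Longrightarrow> sq x = sq y"
  unfolding sq_def by (intro sum.cong) auto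

lemma sq_nonneg: "sq x \<ge> 0"
  unfolding sq_def by (intro sum_nonneg) auto

lemma qf_scale: "qf (\<lambda>v. c * x v) = c\<^sup>2 * qf x"
  unfolding qf_def sum_distrib_left by (intro sum.cong) (auto simp: power2_eq_square)

lemma sq_scale: "sq (\<lambda>v. c * x v) = c\<^sup>2 * sq x"
  unfolding sq_def sum_distrib_left by (intro sum.cong) (auto simp: power2_eq_square)

text \<open>The function space carries the product topology, so values off \<open>V\<close> must be
  pinned to 0. The sphere is then a closed subset of a product of intervals and points, and
  Tychonoff applies.\<close>

lemma compact_unit_sphere:
  "compact {x. (\<forall>v. v \<notin> V \<longrightarrow> x v = (0::real)) \<and> sq x = 1}"
proof -
  let ?B = "\<lambda>v. if v \<in> V then {-1..1} else {0::real}"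
  have "compactin (product_topology (\<lambda>i. euclidean) UNIV) (PiE UNIV ?B)"
    by (subst compactin_PiE) auto
  then have c: "compact (PiE UNIV ?B)"
    unfolding euclidean_product_topology by simp
  have "continuous_on UNIV (\<lambda>x :: 'a \<Rightarrow> real. sq x)"
    unfolding sq_def by (intro continuous_intros continuous_on_product_coordinates)
  then have "closed {x :: 'a \<Rightarrow> real. sq x = 1}"
    by (intro closed_Collect_eq) auto
  with c have "compact (PiE UNIV ?B \<inter> {x. sq x = 1})"
    by (rule compact_Int_closed)
  also have "PiE UNIV ?B \<inter> {x. sq x = 1} = {x. (\<forall>v. v \<notin> V \<longrightarrow> x v = (0::real)) \<and> sq x = 1}"
  proof -
    have "x v \<in> {-1..1}" if "sq x = 1" "v \<in> V" for x v
    proof -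
      have "(x v)\<^sup>2 \<le> sq x"
        unfolding sq_def by (rule member_le_sum) (use that in auto)
      then show ?thesis
        using that abs_le_square_iff[of "x v" 1] by auto
    qed
    then show ?thesis
      by (auto simp: PiE_iff split: if_splits)
  qed
  finally show ?thesis .
qed

lemma perron_vector_exists:
  assumes ne: "V \<noteq> {}"
  obtains l x where "\<And>v. x v \<ge> (0::real)" "sq x = 1" "qf x = l * sq x" "\<And>y. qf y \<le> l * sq y"
    "\<And>v. v \<in> V \<Longrightarrow> (\<Sum>w\<in>E `` {v}. x w) = l * x v"
proof -
  let ?K = "{x. (\<forall>v. v \<notin> V \<longrightarrow> x v = (0::real)) \<and> sq x = 1}"
  obtain v0 where v0: "v0 \<in> V"
    using ne by auto
  define e :: "'a \<Rightarrow> real" where "e v = (if v = v0 then 1 else 0)" for v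
  have "sq e = (\<Sum>v\<in>V. if v = v0 then 1 else 0)"
    unfolding sq_def e_def by (intro sum.cong) auto
  then have "e \<in> ?K"
    using v0 by (auto simp: e_def)
  then have ne': "?K \<noteq> {}"
    by (metis (lifting) empty_iff)
  have cont: "continuous_on ?K qf"
    unfolding qf_def split_def
    by (intro continuous_intros continuous_on_subset[OF continuous_on_product_coordinates]) auto
  obtain x0 where x0: "x0 \<in> ?K" "\<forall>y\<in>?K. qf y \<le> qf x0"
    using continuous_attains_sup[OF compact_unit_sphere ne' cont] by (rule bexE)
  define l where "l = qf x0"
  have max: "qf y \<le> l * sq y" for y
  proof (cases "sq y = 0")
    case True
    then have "y v = 0" if "v \<in> V" for v
      using that unfolding sq_def by (subst (asm) sum_nonneg_eq_0_iff) auto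
    then have "qf y = 0"
      unfolding qf_eq by (intro sum.neutral) auto
    then show ?thesis
      using True by simp
  next
    case False
    then have pos: "sq y > 0"
      using sq_nonneg[of y] by simp
    let ?y = "\<lambda>v. if v \<in> V then (1 / sqrt (sq y)) * y v else 0"
    have "qf ?y = qf (\<lambda>v. (1 / sqrt (sq y)) * y v)" "sq ?y = sq (\<lambda>v. (1 / sqrt (sq y)) * y v)"
      by (auto intro!: qf_cong sq_cong)
    then have s: "qf ?y = qf y / sq y" "sq ?y = 1"
      unfolding qf_scale sq_scale using pos by (auto simp: power_divide)
    then have "qf ?y \<le> l"
      unfolding l_def by (intro x0(2)[rule_format]) auto
    then show ?thesis
      using pos unfolding s by (simp add: field_simps)
  qed
  \<comment> \<open>Absolute values preserve \<open>sq\<close> and cannot lower \<open>qf\<close>,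
    since adjacency entries are nonnegative. Hence a nonnegative maximiser exists.\<close>
  define x where "x v = \<bar>x0 v\<bar>" for v
  have sx: "sq x = 1"
    using x0(1) unfolding sq_def x_def by auto
  have "l \<le> qf x"
    unfolding l_def qf_def x_def by (intro sum_mono) (auto simp: abs_mult[symmetric])
  then have "qf x = l * sq x"
    using max[of x] sx by simp
  moreover from rayleigh_equality[OF max this]
  have "\<And>v. v \<in> V \<Longrightarrow> (\<Sum>w\<in>E `` {v}. x w) = l * x v" .
  ultimately show thesis
    using that[of x l] sx max by (simp add: x_def)
qed

end

lemma pair_graph_sgraph: "pair_graph G \<Longrightarrow> sgraph (pverts G) (parcs G)"
proof -
  assume "pair_graph G"
  then interpret pair_graph G .
  show ?thesis
  proof
    show "finite (pverts G)"
      by (rule pair_finite_verts)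
    show "parcs G \<subseteq> pverts G \<times> pverts G"
      using in_arcsD1 in_arcsD2 by auto
    show "(u, v) \<in> parcs G \<Longrightarrow> (v, u) \<in> parcs G" for u v
      using pair_sym_arcs by (auto simp: symmetric_def dest: symD)
    show "(u, u) \<notin> parcs G" for u
      using pair_no_loops by force
  qed
qed

lemma adjacency_matrix_mult:
  assumes vs: "distinct vs" "set vs = pverts G" and G: "sgraph (pverts G) (parcs G)"
    and v: "v \<in> carrier_vec (length vs)" and i: "i < length vs"
    and f: "\<And>i. i < length vs \<Longrightarrow> f (vs ! i) = vec_index v i"
  shows "vec_index (adjacency_matrix G vs *\<^sub>v v) i = (\<Sum>w\<in>parcs G `` {vs ! i}. f w)"
proof -
  interpret sgraph "pverts G" "parcs G"
    by (rule G)
  have "vec_index (adjacency_matrix G vs *\<^sub>v v) i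
      = (\<Sum>j<length vs. (if (vs ! i, vs ! j) \<in> parcs G then 1 else 0) * vec_index v j)"
    using v i unfolding adjacency_matrix_def
    by (simp add: scalar_prod_def atLeast0LessThan)
  also have "\<dots> = (\<Sum>j<length vs. if (vs ! i, vs ! j) \<in> parcs G then f (vs ! j) else 0)"
    by (intro sum.cong) (auto simp: f)
  also have "\<dots> = (\<Sum>w\<in>pverts G. if (vs ! i, w) \<in> parcs G then f w else 0)"
    by (rule sum.reindex_bij_betw[OF bij_betw_nth]) (use vs in auto)
  also have "\<dots> = (\<Sum>w\<in>parcs G `` {vs ! i}. f w)"
    by (rule sum.mono_neutral_cong_right) (auto dest: E_V)
  finally show ?thesis .
qed

text \<open>The maximal Rayleigh quotient \<open>l\<close> is an eigenvalue, hence at most the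
  spectral radius. Conversely, the moduli of a complex eigenvector for m satisfy |m| g <= A g
  entrywise, so the quotient at g is at least |m|. This bypasses diagonalisation and the reality of
  the spectrum.\<close>

theorem spectral_radius_rayleigh:
  assumes G: "pair_graph G" and ne: "pverts G \<noteq> {}"
  obtains x where "\<And>v. x v \<ge> (0::real)" "sgraph.sq (pverts G) x = 1"
    "\<And>v. v \<in> pverts G \<Longrightarrow> (\<Sum>w\<in>parcs G `` {v}. x w) = graph_spectral_radius G * x v"
    "\<And>y. sgraph.qf (parcs G) y \<le> graph_spectral_radius G * sgraph.sq (pverts G) y"
proof -
  interpret sgraph "pverts G" "parcs G"
    by (rule pair_graph_sgraph[OF G])
  obtain l x where x: "\<And>v. x v \<ge> (0::real)" "sq x = 1" "qf x = l * sq x" and max: "\<And>y. qf y \<le> l * sq y"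
    and eig: "\<And>v. v \<in> pverts G \<Longrightarrow> (\<Sum>w\<in>parcs G `` {v}. x w) = l * x v"
    by (rule perron_vector_exists[OF ne]) (rule that; assumption)
  define vs where "vs = (SOME vs. distinct vs \<and> set vs = pverts G)"
  have "\<exists>vs. distinct vs \<and> set vs = pverts G"
    using finite_distinct_list[OF fin_V] by auto
  then have vs: "distinct vs" "set vs = pverts G"
    unfolding vs_def using someI_ex[of "\<lambda>vs. distinct vs \<and> set vs = pverts G"] by auto
  define N where "N = length vs"
  have N: "N > 0"
    using ne vs unfolding N_def by (cases vs) auto
  define A where "A = adjacency_matrix G vs"
  have A: "A \<in> carrier_mat N N"
    unfolding A_def N_def adjacency_matrix_def by simp
  have r: "graph_spectral_radius G = spectral_radius A"
    unfolding graph_spectral_radius_def vs_def A_def by simp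
  have l0: "0 \<le> l"
  proof -
    have "0 \<le> qf x"
      unfolding qf_def by (intro sum_nonneg) (auto simp: x)
    then show ?thesis
      using x by simp
  qed
  have "l \<le> spectral_radius A"
  proof -
    define y :: "complex vec" where "y = Matrix.vec N (\<lambda>i. of_real (x (vs ! i)))"
    have y: "y \<in> carrier_vec N"
      by (simp add: y_def)
    have "A *\<^sub>v y = of_real l \<cdot>\<^sub>v y"
    proof (rule eq_vecI)
      fix i assume "i < dim_vec (of_real l \<cdot>\<^sub>v y)"
      then have i: "i < N"
        using y by simp
      have "vec_index (A *\<^sub>v y) i = (\<Sum>w\<in>parcs G `` {vs ! i}. of_real (x w))"
        unfolding A_def
        by (rule adjacency_matrix_mult[OF vs pair_graph_sgraph[OF G]])
           (use i y in \<open>auto simp: N_def y_def\<close>)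
      also have "\<dots> = of_real (\<Sum>w\<in>parcs G `` {vs ! i}. x w)"
        by (rule of_real_sum[symmetric])
      also have "(\<Sum>w\<in>parcs G `` {vs ! i}. x w) = l * x (vs ! i)"
        using i vs by (intro eig) (metis N_def nth_mem)
      finally show "vec_index (A *\<^sub>v y) i = vec_index (of_real l \<cdot>\<^sub>v y) i"
        using i by (simp add: y_def)
    qed (use A y in auto)
    moreover have "y \<noteq> 0\<^sub>v N"
    proof
      assume 0: "y = 0\<^sub>v N"
      have "x v = 0" if v: "v \<in> pverts G" for v
      proof -
        obtain i where i: "i < N" "v = vs ! i"
          using v vs unfolding N_def by (metis in_set_conv_nth)
        then have "vec_index y i = 0"
          using 0 by simp
        with i show ?thesis
          by (simp add: y_def)
      qed
      then have "sq x = 0"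
        unfolding sq_def by simp
      with x show False
        by simp
    qed
    ultimately have "eigenvalue A (of_real l)"
      unfolding eigenvalue_def eigenvector_def using y A by auto
    then have "norm (of_real l :: complex) \<in> norm ` spectrum A"
      unfolding spectrum_def by blast
    then show ?thesis
      using spectral_radius_mem_max(2)[OF A N] l0 by fastforce
  qed
  moreover have "spectral_radius A \<le> l"
  proof -
    obtain m where m: "eigenvalue A m" "spectral_radius A = cmod m"
      using spectral_radius_mem_max(1)[OF A N] unfolding spectrum_def by auto
    then obtain y where y: "y \<in> carrier_vec N" "y \<noteq> 0\<^sub>v N" "A *\<^sub>v y = m \<cdot>\<^sub>v y"
      unfolding eigenvalue_def eigenvector_def using A by auto
    define f where "f v = vec_index y (the_inv_into {..<N} ((!) vs) v)" for v
    have bij: "bij_betw ((!) vs) {..<N} (pverts G)"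
      unfolding N_def by (rule bij_betw_nth) (use vs in auto)
    have f: "f (vs ! i) = vec_index y i" if "i < N" for i
      unfolding f_def using that bij
      by (subst the_inv_into_f_f) (auto simp: bij_betw_def)
    have f_eig: "(\<Sum>w\<in>parcs G `` {v}. f w) = m * f v" if v: "v \<in> pverts G" for v
    proof -
      obtain i where i: "i < N" "v = vs ! i"
        using v vs unfolding N_def by (metis in_set_conv_nth)
      have "vec_index (A *\<^sub>v y) i = (\<Sum>w\<in>parcs G `` {vs ! i}. f w)"
        unfolding A_def
        by (rule adjacency_matrix_mult[OF vs pair_graph_sgraph[OF G]])
           (use i y f in \<open>auto simp: N_def\<close>)
      then show ?thesis
        using i y f by simp
    qed
    define g where "g v = cmod (f v)" for v
    have "cmod m * (g v)\<^sup>2 \<le> g v * (\<Sum>w\<in>parcs G `` {v}. g w)" if v: "v \<in> pverts G" for v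
    proof -
      have "cmod m * g v = cmod (\<Sum>w\<in>parcs G `` {v}. f w)"
        unfolding f_eig[OF v] g_def by (simp add: norm_mult)
      also have "\<dots> \<le> (\<Sum>w\<in>parcs G `` {v}. g w)"
        unfolding g_def by (rule norm_sum)
      finally have "g v * (cmod m * g v) \<le> g v * (\<Sum>w\<in>parcs G `` {v}. g w)"
        by (intro mult_left_mono) (auto simp: g_def)
      then show ?thesis
        by (simp add: power2_eq_square algebra_simps)
    qed
    then have "cmod m * sq g \<le> qf g"
      unfolding sq_def qf_eq sum_distrib_left by (intro sum_mono)
    also have "\<dots> \<le> l * sq g"
      by (rule max)
    finally have le: "cmod m * sq g \<le> l * sq g" .
    have "\<exists>i<N. vec_index y i \<noteq> 0"
    proof (rule ccontr)
      assume "\<not> ?thesis"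
      then have "y = 0\<^sub>v N"
        using y(1) by (intro eq_vecI) auto
      with y(2) show False ..
    qed
    then obtain i where i: "i < N" "vec_index y i \<noteq> 0"
      by blast
    have "vs ! i \<in> pverts G"
      using i vs by (metis N_def nth_mem)
    then have "(g (vs ! i))\<^sup>2 \<le> sq g"
      unfolding sq_def by (intro member_le_sum) auto
    moreover have "g (vs ! i) \<noteq> 0"
      using i f unfolding g_def by auto
    ultimately have "sq g > 0"
      by (smt (verit) zero_less_power2)
    then show ?thesis
      using le m by simp
  qed
  ultimately have "graph_spectral_radius G = l"
    using r by simp
  then show thesis
    using that[of x] x max eig by simp
qed

section \<open>Planarity excludes three vertices with three common neighbours\<close>

text \<open>Serves to place an arc on one side of a Jordan curve that it touches at most at its
  final point.\<close>

lemma connected_arc_minus_finish: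
  assumes "arc g"
  shows "topological_space_class.connected (path_image g - {pathfinish g})"
proof -
  have inj: "inj_on g {0..1}" and cont: "continuous_on {0..1} g"
    using assms by (auto simp: arc_def path_def)
  have "path_image g - {pathfinish g} = g ` ({0..1} - {1})"
    unfolding path_image_def pathfinish_def
    using inj_on_image_set_diff[OF inj, of "{0..1}" "{1}"] by simp
  also have "{0..1} - {1} = {0..<1::real}"
    by auto
  finally show ?thesis
    using connected_continuous_image[OF continuous_on_subset[OF cont, of "{0..<1}"]]
    by (simp add: atLeastLessThan_subseteq_atLeastAtMost_iff)
qed

lemma connected_subset_of_two:
  assumes "topological_space_class.connected X" "X \<subseteq> U \<union> U'" "open U" "open U'" "U \<inter> U' = {}" "X \<inter> U \<noteq> {}"
  shows "X \<inter> U' = {}"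
proof -
  have "U \<inter> U' \<inter> X = {}"
    using assms(5) by simp
  then show ?thesis
    using connectedD[OF assms(1,3,4) _ assms(2)] assms(6) by (simp add: Int_commute)
qed

text \<open>
  In a drawing of \<open>K\<^sub>3\<^sub>,\<^sub>3\<close> the points \<open>a 2\<close> and \<open>b 2\<close> lie on the same side \<open>U\<close> of
  the closed curve \<open>J\<close> through \<open>a 0, b 0, a 1, b 1\<close>. The path through \<open>b 0, a 2, b 1\<close>
  together with either half of \<open>J\<close> does not separate \<open>b 2\<close> from the other side of \<open>J\<close>, since
  one can cross at \<open>a 0\<close> or at \<open>a 1\<close>. By Janiszewski's theorem the whole of \<open>J\<close> would not
  separate them either.
\<close>

lemma no_planar_K33:
  fixes g :: "nat \<Rightarrow> nat \<Rightarrow> real \<Rightarrow> complex"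
  assumes arc: "\<And>i j. i < 3 \<Longrightarrow> j < 3 \<Longrightarrow> arc (g i j)"
    and start: "\<And>i j. i < 3 \<Longrightarrow> j < 3 \<Longrightarrow> pathstart (g i j) = a i"
    and finish: "\<And>i j. i < 3 \<Longrightarrow> j < 3 \<Longrightarrow> pathfinish (g i j) = b j"
    and a_notin: "\<And>i k j. i < 3 \<Longrightarrow> k < 3 \<Longrightarrow> j < 3 \<Longrightarrow> i \<noteq> k \<Longrightarrow> a i \<notin> path_image (g k j)"
    and b_notin: "\<And>i k j. i < 3 \<Longrightarrow> k < 3 \<Longrightarrow> j < 3 \<Longrightarrow> j \<noteq> k \<Longrightarrow> b j \<notin> path_image (g i k)"
    and meet_a: "\<And>i j k. i < 3 \<Longrightarrow> j < 3 \<Longrightarrow> k < 3 \<Longrightarrow> j \<noteq> k \<Longrightarrow>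
      path_image (g i j) \<inter> path_image (g i k) \<subseteq> {a i}"
    and meet_b: "\<And>i k j. i < 3 \<Longrightarrow> j < 3 \<Longrightarrow> k < 3 \<Longrightarrow> i \<noteq> k \<Longrightarrow>
      path_image (g i j) \<inter> path_image (g k j) \<subseteq> {b j}"
    and disj: "\<And>i j k l. i < 3 \<Longrightarrow> j < 3 \<Longrightarrow> k < 3 \<Longrightarrow> l < 3 \<Longrightarrow> i \<noteq> k \<Longrightarrow> j \<noteq> l \<Longrightarrow>
      path_image (g i j) \<inter> path_image (g k l) = {}"
  shows False
proof -
  define W where "W i j = path_image (g i j)" for i j
  have aW: "a i \<in> W i j" and bW: "b j \<in> W i j" and cW: "topological_space_class.connected (W i j)" and kW: "compact (W i j)"
    if "i < 3" "j < 3" for i j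
    using arc[OF that] start[OF that] finish[OF that] unfolding W_def
    by (auto simp: arc_imp_path connected_path_image compact_path_image)
       (metis pathstart_in_path_image, metis pathfinish_in_path_image)
  note a_n = a_notin[folded W_def] and b_n = b_notin[folded W_def]
    and mA = meet_a[folded W_def] and mB = meet_b[folded W_def] and dj = disj[folded W_def]
  define c1 where "c1 = reversepath (g 0 0) +++ g 0 1"
  define c2 where "c2 = reversepath (g 1 1) +++ g 1 0"
  define J1 where "J1 = W 0 0 \<union> W 0 1"
  define J2 where "J2 = W 1 0 \<union> W 1 1"
  define K where "K = W 2 0 \<union> W 2 1"
  have im: "path_image c1 = J1" "path_image c2 = J2"
    unfolding c1_def c2_def J1_def J2_def W_def
    by (auto simp: path_image_join start finish)
  have ends: "pathstart c1 = b 0" "pathfinish c1 = b 1" "pathstart c2 = b 1" "pathfinish c2 = b 0"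
    unfolding c1_def c2_def by (auto simp: start finish)
  have arcs: "arc c1" "arc c2"
    unfolding c1_def c2_def using mA[of 0 0 1] mA[of 1 1 0]
    by (auto intro!: arc_join simp: arc arc_reversepath start finish W_def)
  have J12: "J1 \<inter> J2 \<subseteq> {b 0, b 1}"
    unfolding J1_def J2_def using mB[of 0 0 1] mB[of 0 1 1] dj[of 0 0 1 1] dj[of 0 1 1 0] by auto
  have simple: "simple_path (c1 +++ c2)"
    using arcs J12 by (intro simple_path_join_loop) (auto simp: ends im)
  define J where "J = J1 \<union> J2"
  have imJ: "path_image (c1 +++ c2) = J"
    by (simp add: path_image_join ends im J_def)
  have a2: "a 2 \<notin> J"
    unfolding J_def J1_def J2_def by (auto simp: a_n)
  note jordan = Jordan_inside_outside[OF simple, unfolded imJ]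
  \<comment> \<open>It is unknown whether \<open>a 2\<close> lies inside or outside. What follows
    uses only properties shared by both sides, so \<open>U\<close> names the side of
    \<open>a 2\<close> and \<open>U'\<close> the other one.\<close>
  have "\<exists>U U'. open U \<and> open U' \<and> topological_space_class.connected U' \<and> U' \<noteq> {} \<and> U \<inter> U' = {} \<and> U \<union> U' = - J
    \<and> frontier U' = J \<and> a 2 \<in> U"
  proof (cases "a 2 \<in> inside J")
    case True
    then show ?thesis
      using jordan by (intro exI[of _ "inside J"] exI[of _ "outside J"]) (simp add: ends)
  next
    case False
    then have "a 2 \<in> outside J"
      using a2 inside_Un_outside[of J] by blast
    then show ?thesis
      using jordan by (intro exI[of _ "outside J"] exI[of _ "inside J"]) (simp add: ends Int_commute Un_commute)
  qed
  then obtain U U' where U: "open U" "open U'" "topological_space_class.connected U'" "U' \<noteq> {}" "U \<inter> U' = {}" "U \<union> U' = - J"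
    "frontier U' = J" "a 2 \<in> U"
    by (elim exE conjE)
  have side: "X \<inter> U' = {}" if "topological_space_class.connected X" "X \<inter> J = {}" "X \<inter> U \<noteq> {}" for X
    using connected_subset_of_two[OF that(1) _ U(1,2,5) that(3)] that(2) U(6) by blast
  have W2: "W 2 j \<inter> J \<subseteq> {b j}" if "j < 2" for j
  proof -
    from that consider "j = 0" | "j = 1" by linarith
    then show ?thesis
      unfolding J_def J1_def J2_def
      by cases (use mB[of 2 0 0] mB[of 2 0 1] dj[of 2 0 0 1] dj[of 2 0 1 1]
        mB[of 2 1 0] mB[of 2 1 1] dj[of 2 1 0 0] dj[of 2 1 1 0] in auto)
  qed
  have WU: "(W 2 j - {b j}) \<inter> U' = {}" if "j < 2" for j
  proof (rule side)
    show "topological_space_class.connected (W 2 j - {b j})"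
      using connected_arc_minus_finish[OF arc[of 2 j]] finish[of 2 j] that by (simp add: W_def)
    show "(W 2 j - {b j}) \<inter> J = {}"
      using W2[OF that] by blast
    have "a 2 \<noteq> b j"
      using arc_distinct_ends[OF arc[of 2 j]] start[of 2 j] finish[of 2 j] that by simp
    then show "(W 2 j - {b j}) \<inter> U \<noteq> {}"
      using aW[of 2 j] U(8) that by auto
  qed
  have "b 0 \<in> J" "b 1 \<in> J"
    unfolding J_def J1_def using bW by auto
  then have "b 0 \<notin> U'" "b 1 \<notin> U'"
    using U(6) by auto
  then have KU: "K \<inter> U' = {}"
    unfolding K_def using WU[of 0] WU[of 1] by auto
  have b2: "b 2 \<in> U"
  proof -
    have "W 2 2 \<inter> J = {}"
      unfolding J_def J1_def J2_def using dj[of 2 2 0 0] dj[of 2 2 0 1] dj[of 2 2 1 0] dj[of 2 2 1 1]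
      by auto
    then have "W 2 2 \<inter> U' = {}"
      using side[of "W 2 2"] cW[of 2 2] aW[of 2 2] U(8) by auto
    then show ?thesis
      using bW[of 2 2] \<open>W 2 2 \<inter> J = {}\<close> U(6) by auto
  qed
  obtain q where q: "q \<in> U'"
    using U by blast
  \<comment> \<open>The connecting set is the arc between \<open>b 2\<close> and \<open>a i\<close>
    together with \<open>U'\<close>. It is connected because the frontier point \<open>a i\<close>
    can be added to \<open>U'\<close>; it avoids \<open>K\<close>, and it avoids \<open>J'\<close>
    since \<open>a i\<close> is on the other half of the curve.\<close>
  have cross: "connected_component (- (J' \<union> K)) (b 2) q"
    if "i < 2" "J' \<subseteq> J" "W i 2 \<inter> J' = {}" for i J'
  proof -
    have aJ: "a i \<in> J"
      using that(1) aW unfolding J_def J1_def J2_def less_2_cases_iff by auto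
    have "a i \<in> closure U'"
      using aJ U(7) unfolding frontier_def by blast
    then have "topological_space_class.connected (insert (a i) U')"
      using connected_intermediate_closure[OF U(3), of "insert (a i) U'"] closure_subset by auto
    moreover have "topological_space_class.connected (W i 2)"
      using cW that by simp
    ultimately have "topological_space_class.connected (W i 2 \<union> insert (a i) U')"
      using aW[of i 2] that by (intro connected_Un) auto
    moreover have "W i 2 \<inter> K = {}"
      unfolding K_def using dj[of i 2 2 0] dj[of i 2 2 1] that by auto
    moreover have "U' \<inter> J' = {}"
      using that U(6) by blast
    ultimately show ?thesis
      unfolding connected_component_def using KU that(1,3) aW[of i 2] bW[of i 2] q
      by (intro exI[of _ "W i 2 \<union> insert (a i) U'"]) auto
  qed
  have "connected_component (- ((J1 \<union> K) \<union> (J2 \<union> K))) (b 2) q"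
  proof (rule Janiszewski)
    show "compact (J1 \<union> K)"
      unfolding J1_def K_def by (auto intro!: compact_Un kW)
    show "closed (J2 \<union> K)"
      unfolding J2_def K_def by (auto intro!: compact_imp_closed compact_Un kW)
    \<comment> \<open>Janiszewski's theorem requires a connected intersection. \<open>J1\<close> and
      \<open>J2\<close> alone meet in two points, which are joined by the path \<open>K\<close>
      added to both.\<close>
    have "(J1 \<union> K) \<inter> (J2 \<union> K) = K"
      using J12 bW[of 2 0] bW[of 2 1] unfolding K_def by auto
    moreover have "topological_space_class.connected K"
      unfolding K_def using aW[of 2 0] aW[of 2 1] by (intro connected_Un cW) auto
    ultimately show "topological_space_class.connected ((J1 \<union> K) \<inter> (J2 \<union> K))"
      by simp
    show "connected_component (- (J1 \<union> K)) (b 2) q"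
      by (rule cross[of 1]) (use dj[of 1 2 0 0] dj[of 1 2 0 1] in \<open>auto simp: J_def J1_def\<close>)
    show "connected_component (- (J2 \<union> K)) (b 2) q"
      by (rule cross[of 0]) (use dj[of 0 2 1 0] dj[of 0 2 1 1] in \<open>auto simp: J_def J2_def\<close>)
  qed
  then obtain X where X: "topological_space_class.connected X" "X \<subseteq> - ((J1 \<union> K) \<union> (J2 \<union> K))" "b 2 \<in> X" "q \<in> X"
    unfolding connected_component_def by blast
  have "X \<inter> U' = {}"
    by (rule side) (use X b2 in \<open>auto simp: J_def\<close>)
  with X q show False
    by blast
qed

theorem planar_no_K33:
  assumes G: "pair_graph G" "planar G"
    and dist: "distinct [a0, a1, a2, b0, b1, b2 :: 'a]"
    and adj: "{a0, a1, a2} \<times> {b0, b1, b2} \<subseteq> parcs G"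
  shows False
proof -
  interpret sgraph "pverts G" "parcs G"
    by (rule pair_graph_sgraph[OF G(1)])
  obtain p \<gamma> where d: "planar_drawing G p \<gamma>"
    using G(2) unfolding planar_def by blast
  have inj: "inj_on p (pverts G)"
    using d unfolding planar_drawing_def by blast
  define a where "a i = [a0, a1, a2] ! i" for i
  define b where "b i = [b0, b1, b2] ! i" for i
  have da: "a i = a k \<longleftrightarrow> i = k" "b i = b k \<longleftrightarrow> i = k" if "i < 3" "k < 3" for i k
    unfolding a_def b_def using that dist by (subst nth_eq_iff_index_eq; auto)+
  have dab: "a i \<noteq> b k" if "i < 3" "k < 3" for i k
  proof -
    have "a i \<in> {a0, a1, a2}" "b k \<in> {b0, b1, b2}"
      using nth_mem[of i "[a0, a1, a2]"] nth_mem[of k "[b0, b1, b2]"] that unfolding a_def b_def by auto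
    then show ?thesis
      using dist by auto
  qed
  have ab: "(a i, b j) \<in> parcs G" if "i < 3" "j < 3" for i j
    using nth_mem[of i "[a0, a1, a2]"] nth_mem[of j "[b0, b1, b2]"] that adj unfolding a_def b_def
    by auto
  have aV: "a i \<in> pverts G" and bV: "b i \<in> pverts G" if "i < 3" for i
    using ab[OF that, of 0] ab[of 0, OF _ that] E_V by auto
  have e: "{a i, b j} \<in> edges G" if "i < 3" "j < 3" for i j
    using ab[OF that] unfolding edges_def by force
  \<comment> \<open>Drawings attach arcs to unordered edges, so an arc may run either way; all nine
    are turned to start at their vertex \<open>a i\<close>.\<close>
  have "\<exists>g. arc g \<and> pathstart g = p (a i) \<and> pathfinish g = p (b j)
      \<and> path_image g = path_image (\<gamma> {a i, b j})" if "i < 3" "j < 3" for i j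
  proof -
    have *: "arc (\<gamma> {a i, b j})"
      "{pathstart (\<gamma> {a i, b j}), pathfinish (\<gamma> {a i, b j})} = {p (a i), p (b j)}"
      using d e[OF that] unfolding planar_drawing_def by auto
    from *(2) consider "pathstart (\<gamma> {a i, b j}) = p (a i)" "pathfinish (\<gamma> {a i, b j}) = p (b j)"
      | "pathstart (\<gamma> {a i, b j}) = p (b j)" "pathfinish (\<gamma> {a i, b j}) = p (a i)"
      by (auto simp: doubleton_eq_iff)
    then show ?thesis
    proof cases
      case 1
      then show ?thesis
        using * by blast
    next
      case 2
      then show ?thesis
        using * by (intro exI[of _ "reversepath (\<gamma> {a i, b j})"]) (simp add: arc_reversepath)
    qed
  qed
  then obtain g where g: "\<And>i j. i < 3 \<Longrightarrow> j < 3 \<Longrightarrow> arc (g i j) \<and> pathstart (g i j) = p (a i) \<and>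
      pathfinish (g i j) = p (b j) \<and> path_image (g i j) = path_image (\<gamma> {a i, b j})"
    by metis
  have vert: "p v \<in> path_image (g i j) \<longleftrightarrow> v = a i \<or> v = b j"
    if "i < 3" "j < 3" "v \<in> pverts G" for i j v
  proof -
    have "path_image (\<gamma> {a i, b j}) \<inter> p ` pverts G = {p (a i), p (b j)}"
      using d e[OF that(1,2)] unfolding planar_drawing_def by auto
    then have "p v \<in> path_image (g i j) \<longleftrightarrow> p v = p (a i) \<or> p v = p (b j)"
      using g[OF that(1,2)] that(3) by auto
    then show ?thesis
      using inj_on_eq_iff[OF inj] that aV bV by metis
  qed
  have meet: "path_image (g i j) \<inter> path_image (g k l) \<subseteq> p ` ({a i, b j} \<inter> {a k, b l})"
    if "i < 3" "j < 3" "k < 3" "l < 3" "i \<noteq> k \<or> j \<noteq> l" for i j k l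
  proof -
    have "{a i, b j} \<noteq> {a k, b l}"
      using that da dab by (metis doubleton_eq_iff)
    then show ?thesis
      using d e[OF that(1,2)] e[OF that(3,4)] g that unfolding planar_drawing_def by metis
  qed
  show False
  proof (rule no_planar_K33[of g "p \<circ> a" "p \<circ> b"])
    fix i j k :: nat
    assume *: "i < 3" "j < 3" "k < 3" "j \<noteq> k"
    show "path_image (g i j) \<inter> path_image (g i k) \<subseteq> {(p \<circ> a) i}"
      using meet[of i j i k] * by (auto simp: da dab dab[symmetric])
  next
    fix i j k :: nat
    assume *: "i < 3" "j < 3" "k < 3" "i \<noteq> k"
    show "path_image (g i j) \<inter> path_image (g k j) \<subseteq> {(p \<circ> b) j}"
      using meet[of i j k j] * by (auto simp: da dab dab[symmetric])
  next
    fix i j k l :: nat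
    assume *: "i < 3" "j < 3" "k < 3" "l < 3" "i \<noteq> k" "j \<noteq> l"
    show "path_image (g i j) \<inter> path_image (g k l) = {}"
      using meet[of i j k l] * by (auto simp: da dab dab[symmetric])
  next
    fix i j k :: nat
    assume *: "i < 3" "k < 3" "j < 3" "i \<noteq> k"
    show "(p \<circ> a) i \<notin> path_image (g k j)"
      using vert[of k j "a i"] * aV da dab by auto
  next
    fix i j k :: nat
    assume *: "i < 3" "k < 3" "j < 3" "j \<noteq> k"
    show "(p \<circ> b) j \<notin> path_image (g i k)"
      using vert[of i k "b j"] * bV da dab[symmetric] by auto
  qed (use g in auto)
qed

section \<open>Vertex sets of minimum degree two\<close>

context sgraph
begin

text \<open>A set of vertices inducing minimum degree at least two; the minimal ones are the cycles.\<close>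

definition core :: "'a set \<Rightarrow> bool" where
  "core S \<longleftrightarrow> S \<noteq> {} \<and> S \<subseteq> V \<and> (\<forall>v\<in>S. 2 \<le> card (E `` {v} \<inter> S))"

text \<open>Since the minimal cores are cycles, these are the vertex sets that induce a
  forest.\<close>

definition coreless :: "'a set \<Rightarrow> bool" where
  "coreless X \<longleftrightarrow> X \<subseteq> V \<and> (\<forall>S\<subseteq>X. \<not> core S)"

text \<open>Ordered pairs are counted: for disjoint \<open>S\<close> and \<open>T\<close> this is
  the number of edges between them, but for \<open>S = T\<close> it is twice the number of edges
  inside.\<close>

definition ec :: "'a set \<Rightarrow> 'a set \<Rightarrow> nat" where
  "ec S T = card (E \<inter> S \<times> T)"

lemma coreless_mono: "coreless X \<Longrightarrow> Y \<subseteq> X \<Longrightarrow> coreless Y"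
  unfolding coreless_def by blast

text \<open>Weighted form of the bound for forests. As \<open>X\<close> itself is not a core, some
  vertex \<open>v\<close> has at most one neighbour in \<open>X\<close>; deleting it loses at most
  \<open>2 * x v * d\<close>. Unit weights give the usual edge count, the entries of the eigenvector
  give the loss estimate in the final comparison.\<close>

lemma coreless_weight:
  assumes "coreless X" and "\<And>v. v \<in> X \<Longrightarrow> 0 \<le> x v \<and> x v \<le> (d::real)"
  shows "(\<Sum>(u, v)\<in>E \<inter> X \<times> X. x u * x v) \<le> 2 * d * (\<Sum>v\<in>X. x v)"
proof -
  have "finite X"
    using assms(1) fin_V unfolding coreless_def by (auto intro: finite_subset)
  then show ?thesis
    using assms
  proof (induction X rule: finite_psubset_induct)
    case (psubset X)
    show ?case
    proof (cases "X = {}")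
      case False
      have X: "X \<subseteq> V" "\<not> core X"
        using psubset.prems(1) unfolding coreless_def by auto
      then obtain v where v: "v \<in> X" "card (E `` {v} \<inter> X) < 2"
        using False unfolding core_def by (meson not_le)
      define N where "N = E `` {v} \<inter> X"
      let ?Y = "X - {v}"
      let ?f = "\<lambda>(u, v). x u * x v"
      have dec: "E \<inter> X \<times> X = E \<inter> ?Y \<times> ?Y \<union> (Pair v ` N \<union> (\<lambda>w. (w, v)) ` N)"
        unfolding N_def using v(1) E_sym by auto
      have fN: "finite N"
        unfolding N_def by simp
      have vN: "v \<notin> N"
        unfolding N_def by simp
      have "(\<Sum>p\<in>E \<inter> X \<times> X. ?f p)
          = (\<Sum>p\<in>E \<inter> ?Y \<times> ?Y. ?f p) + ((\<Sum>p\<in>Pair v ` N. ?f p) + (\<Sum>p\<in>(\<lambda>w. (w, v)) ` N. ?f p))"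
        unfolding dec using fN vN
        by (subst sum.union_disjoint; (subst sum.union_disjoint)?) auto
      also have "(\<Sum>p\<in>Pair v ` N. ?f p) = x v * (\<Sum>w\<in>N. x w)"
        by (subst sum.reindex) (auto simp: inj_on_def sum_distrib_left)
      also have "(\<Sum>p\<in>(\<lambda>w. (w, v)) ` N. ?f p) = x v * (\<Sum>w\<in>N. x w)"
        by (subst sum.reindex) (auto simp: inj_on_def sum_distrib_left mult.commute)
      finally have eq: "(\<Sum>p\<in>E \<inter> X \<times> X. ?f p)
          = (\<Sum>p\<in>E \<inter> ?Y \<times> ?Y. ?f p) + 2 * (x v * (\<Sum>w\<in>N. x w))"
        by simp
      have "(\<Sum>p\<in>E \<inter> ?Y \<times> ?Y. ?f p) \<le> 2 * d * (\<Sum>u\<in>?Y. x u)"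
        by (rule psubset.IH) (use v psubset.prems coreless_mono[of X ?Y] in auto)
      \<comment> \<open>\<open>N\<close> has at most one element; if it is empty,
        \<open>0 <= d\<close> follows from the bounds at \<open>v\<close>.\<close>
      moreover have "(\<Sum>w\<in>N. x w) \<le> d"
      proof -
        have "card N = 0 \<or> card N = 1"
          using v(2) unfolding N_def by linarith
        then consider "N = {}" | w where "N = {w}"
          using fN by (metis card_0_eq card_1_singletonE)
        then show ?thesis
        proof cases
          case 1
          then show ?thesis
            using psubset.prems(2)[OF v(1)] by simp
        next
          case 2
          then have "w \<in> X"
            unfolding N_def by auto
          then show ?thesis
            using 2 psubset.prems(2) by simp
        qed
      qed
      then have "x v * (\<Sum>w\<in>N. x w) \<le> x v * d"
        using psubset.prems(2)[OF v(1)] by (intro mult_left_mono) auto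
      moreover have "(\<Sum>u\<in>X. x u) = x v + (\<Sum>u\<in>?Y. x u)"
        using psubset.hyps v(1) by (rule sum.remove)
      ultimately show ?thesis
        unfolding eq by (simp add: algebra_simps)
    qed simp
  qed
qed

lemma coreless_edges: "coreless X \<Longrightarrow> ec X X \<le> 2 * card X"
  using coreless_weight[of X "\<lambda>_. 1" 1] unfolding ec_def by (simp add: split_def flip: of_nat_le_iff[where 'a = real])

lemma ec_commute: "ec S T = ec T S"
  unfolding ec_def
  by (rule bij_betw_same_card[of prod.swap], rule bij_betwI[of _ _ _ prod.swap])
     (auto intro: E_sym)

lemma ec_mono: "S \<subseteq> S' \<Longrightarrow> T \<subseteq> T' \<Longrightarrow> ec S T \<le> ec S' T'"
  unfolding ec_def by (intro card_mono) auto

lemma ec_Un_left: "ec (S \<union> S') T \<le> ec S T + ec S' T"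
proof -
  have "E \<inter> (S \<union> S') \<times> T = (E \<inter> S \<times> T) \<union> (E \<inter> S' \<times> T)"
    by auto
  then show ?thesis
    unfolding ec_def by (simp add: card_Un_le)
qed

lemma ec_Un_right: "ec S (T \<union> T') \<le> ec S T + ec S T'"
  using ec_Un_left[of T T' S] by (simp add: ec_commute)

lemma ec_prod: "finite S \<Longrightarrow> finite T \<Longrightarrow> ec S T \<le> card S * card T"
  unfolding ec_def card_cartesian_product[symmetric] by (intro card_mono) auto

lemma ec_sum: "finite S \<Longrightarrow> ec S T = (\<Sum>s\<in>S. card (E `` {s} \<inter> T))"
proof -
  assume "finite S"
  moreover have "E \<inter> S \<times> T = Sigma S (\<lambda>s. E `` {s} \<inter> T)"
    by auto
  ultimately show ?thesis
    unfolding ec_def by (simp add: card_SigmaI)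
qed

lemma coreless_bip:
  assumes "coreless (S \<union> T)" "S \<inter> T = {}"
  shows "ec S T \<le> card S + card T"
proof -
  have fin: "finite S" "finite T"
    using assms(1) fin_V unfolding coreless_def by (auto intro: finite_subset)
  have "ec S T + ec T S \<le> ec (S \<union> T) (S \<union> T)"
    unfolding ec_def using assms(2) by (subst card_Un_disjoint[symmetric]) (auto intro!: card_mono)
  then show ?thesis
    using coreless_edges[OF assms(1)] fin assms(2) by (simp add: ec_commute[of T S] card_Un_disjoint)
qed

lemma coreI:
  assumes "S \<noteq> {}" "S \<subseteq> V"
    and "\<And>v. v \<in> S \<Longrightarrow> \<exists>p\<in>S. \<exists>q\<in>S. p \<noteq> q \<and> (v, p) \<in> E \<and> (v, q) \<in> E"
  shows "core S"
proof -
  have "2 \<le> card (E `` {v} \<inter> S)" if v: "v \<in> S" for v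
  proof -
    obtain p q where pq: "p \<in> S" "q \<in> S" "p \<noteq> q" "(v, p) \<in> E" "(v, q) \<in> E"
      using assms(3)[OF v] by (elim bexE conjE)
    then have "{p, q} \<subseteq> E `` {v} \<inter> S"
      by simp
    then show ?thesis
      using pq(3) card_mono[of "E `` {v} \<inter> S" "{p, q}"] by simp
  qed
  then show ?thesis
    unfolding core_def using assms(1,2) by blast
qed

lemma coreE:
  assumes "core S" "v \<in> S"
  obtains p q where "p \<in> S" "q \<in> S" "p \<noteq> q" "(v, p) \<in> E" "(v, q) \<in> E"
proof -
  have "2 \<le> card (E `` {v} \<inter> S)"
    using assms unfolding core_def by blast
  then obtain T where "T \<subseteq> E `` {v} \<inter> S" "card T = 2"
    by (meson obtain_subset_with_card_n)
  then show thesis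
    using that by (auto simp: card_2_iff)
qed

lemma core_C4:
  assumes "a \<noteq> b" "s \<noteq> t" "{s, t} \<subseteq> E `` {a} \<inter> E `` {b}"
  shows "core {a, b, s, t}"
proof (rule coreI)
  have e: "(a, s) \<in> E" "(a, t) \<in> E" "(b, s) \<in> E" "(b, t) \<in> E"
    "(s, a) \<in> E" "(t, a) \<in> E" "(s, b) \<in> E" "(t, b) \<in> E"
    using assms(3) E_sym by auto
  then show "{a, b, s, t} \<subseteq> V"
    using E_V by blast
  show "\<exists>p\<in>{a, b, s, t}. \<exists>q\<in>{a, b, s, t}. p \<noteq> q \<and> (v, p) \<in> E \<and> (v, q) \<in> E"
    if "v \<in> {a, b, s, t}" for v
    using that e assms(1,2) by blast
qed simp

lemma core_C3:
  assumes "(a, b) \<in> E" "(b, c) \<in> E" "(a, c) \<in> E"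
  shows "core {a, b, c}"
proof (rule coreI)
  have e: "(b, a) \<in> E" "(c, b) \<in> E" "(c, a) \<in> E" "a \<noteq> b" "b \<noteq> c" "a \<noteq> c"
    using assms E_sym by auto
  show "{a, b, c} \<subseteq> V"
    using assms E_V by blast
  show "\<exists>p\<in>{a, b, c}. \<exists>q\<in>{a, b, c}. p \<noteq> q \<and> (v, p) \<in> E \<and> (v, q) \<in> E"
    if "v \<in> {a, b, c}" for v
    using that e assms by blast
qed simp

end

text \<open>The combinatorial content of the two hypotheses on the graph, with drawings and copies
  of cycles eliminated: no two disjoint cores, and no K_{3,3}.\<close>

locale cgraph = sgraph +
  assumes no_disjoint_cores: "core S \<Longrightarrow> core S' \<Longrightarrow> S \<inter> S' \<noteq> {}"
    and no_K33: "distinct [a, b, c] \<Longrightarrow> card (E `` {a} \<inter> E `` {b} \<inter> E `` {c}) \<le> 2"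
begin

lemma coreless_outside_core: "core Q \<Longrightarrow> coreless (V - Q)"
  unfolding coreless_def using no_disjoint_cores by blast

text \<open>Outside \<open>Q\<close> there is a forest, worth 2 per vertex as ordered pairs. Each
  vertex of \<open>S\<close> sees at most 4 vertices of \<open>Q\<close>, counted in both
  directions: 2 + 4 + 4 = 10.\<close>

lemma edges_linear:
  assumes Q: "core Q" "card Q \<le> 4" and S: "S \<subseteq> V"
  shows "ec S S \<le> 10 * card S"
proof -
  have fin: "finite S" "finite Q"
    using S Q(1) unfolding core_def by (auto intro: finite_subset)
  have "S = (S - Q) \<union> (S \<inter> Q)"
    by auto
  then have "ec S S \<le> ec (S - Q) S + ec (S \<inter> Q) S"
    using ec_Un_left[of "S - Q" "S \<inter> Q" S] by simp
  also have "ec (S - Q) S \<le> ec (S - Q) (S - Q) + ec (S - Q) (S \<inter> Q)"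
    using ec_Un_right[of "S - Q" "S - Q" "S \<inter> Q"] \<open>S = (S - Q) \<union> (S \<inter> Q)\<close> by simp
  also have "ec (S - Q) (S - Q) \<le> 2 * card (S - Q)"
    by (rule coreless_edges, rule coreless_mono[OF coreless_outside_core[OF Q(1)]]) (use S in auto)
  also have "card (S - Q) \<le> card S"
    using fin by (simp add: card_mono)
  also have "ec (S - Q) (S \<inter> Q) \<le> ec S Q"
    by (rule ec_mono) auto
  also have "ec (S \<inter> Q) S \<le> ec Q S"
    by (rule ec_mono) auto
  also have "ec Q S = ec S Q"
    by (rule ec_commute)
  also have "ec S Q \<le> card S * card Q"
    using fin by (simp add: ec_prod)
  also have "card S * card Q \<le> card S * 4"
    using Q by simp
  finally show ?thesis
    by simp
qed

text \<open>Used to charge every neighbour beyond the first to an ordered pair of vertices having a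
  common neighbour.\<close>

lemma card_le_pairs:
  assumes "finite X"
  shows "card X \<le> 1 + card {(a, b). a \<in> X \<and> b \<in> X \<and> a \<noteq> b}"
proof (cases "X = {}")
  case False
  then obtain a where a: "a \<in> X"
    by auto
  have fin: "finite {(a, b). a \<in> X \<and> b \<in> X \<and> a \<noteq> b}"
    by (rule finite_subset[of _ "X \<times> X"]) (use assms in auto)
  have "card (Pair a ` (X - {a})) \<le> card {(a, b). a \<in> X \<and> b \<in> X \<and> a \<noteq> b}"
    by (rule card_mono[OF fin]) (use a in auto)
  also have "card (Pair a ` (X - {a})) = card X - 1"
    using a assms by (subst card_image) (auto simp: inj_on_def)
  finally show ?thesis
    by simp
qed simp

text \<open>The coefficient 2 of \<open>card T\<close> is what matters; the terms in
  \<open>card S\<close> are error terms. It arises as one edge per vertex of \<open>T\<close> from a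
  forest plus one more, or as two edges to a fixed pair of vertices in \<open>S\<close>.\<close>

lemma bipartite_edges:
  assumes Q: "core Q" "card Q \<le> 4" and ST: "S \<subseteq> V" "T \<subseteq> V" "S \<inter> T = {}"
  shows "ec S T \<le> 2 * card T + 5 * card S + 16"
proof -
  have fin: "finite S" "finite T" "finite Q"
    using ST Q(1) unfolding core_def by (auto intro: finite_subset)
  show ?thesis
  proof (cases "\<exists>a\<in>S. \<exists>b\<in>S. a \<noteq> b \<and> (\<exists>s\<in>T. \<exists>t\<in>T. s \<noteq> t \<and> {s, t} \<subseteq> E `` {a} \<inter> E `` {b})")
    case True
    then obtain a b s t where ab: "a \<in> S" "b \<in> S" "a \<noteq> b" and st: "s \<in> T" "t \<in> T" "s \<noteq> t"
      and C: "{s, t} \<subseteq> E `` {a} \<inter> E `` {b}"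
      by blast
    define S' where "S' = S - {a, b}"
    \<comment> \<open>Vertices of \<open>T2\<close> send two edges to \<open>{a, b}\<close> and
      together receive at most two from each further vertex of \<open>S\<close>, by the absence of
      K_{3,3}. Vertices of \<open>T1\<close> send at most one edge to \<open>{a, b}\<close>, and the
      rest of \<open>S\<close> meets \<open>T1\<close> in a forest, which costs one more per vertex.
      The coefficient 5 of \<open>card S\<close> is 2 for \<open>{s, t}\<close>, 2 for
      \<open>T2\<close> and 1 for \<open>T1\<close>.\<close>
    define T2 where "T2 = (T - {s, t}) \<inter> (E `` {a} \<inter> E `` {b})"
    define T1 where "T1 = (T - {s, t}) - (E `` {a} \<inter> E `` {b})"
    have fin': "finite S'" "finite T1" "finite T2"
      unfolding S'_def T1_def T2_def using fin by auto
    have Sdec: "S = {a, b} \<union> S'" and Tdec: "T = {s, t} \<union> (T2 \<union> T1)"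
      unfolding S'_def T1_def T2_def using ab st by auto
    have cT: "card T = 2 + (card T2 + card T1)"
    proof -
      have "card (T2 \<union> T1) = card T2 + card T1"
        using fin' by (intro card_Un_disjoint) (auto simp: T1_def T2_def)
      moreover have "card T = card {s, t} + card (T2 \<union> T1)"
        unfolding Tdec using fin' by (intro card_Un_disjoint) (auto simp: T1_def T2_def)
      ultimately show ?thesis
        using st by simp
    qed
    have cS: "card S' \<le> card S"
      unfolding S'_def using fin by (simp add: card_mono)
    have "core {a, b, s, t}"
      by (rule core_C4) (use ab st C in auto)
    then have cl: "coreless (V - {a, b, s, t})"
      by (rule coreless_outside_core)
    have split: "ec X T \<le> ec X {s, t} + (ec X T2 + ec X T1)" for X
      using ec_Un_right[of X "{s, t}" "T2 \<union> T1"] ec_Un_right[of X T2 T1] Tdec by simp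
    have "ec S T \<le> ec {a, b} T + ec S' T"
      using ec_Un_left[of "{a, b}" S' T] Sdec by simp
    moreover have "ec {a, b} {s, t} \<le> 4"
      using ec_prod[of "{a, b}" "{s, t}"] ab st by simp
    moreover have "ec {a, b} T2 \<le> 2 * card T2"
      using ec_prod[of "{a, b}" T2] ab fin' by simp
    moreover have "ec {a, b} T1 \<le> card T1"
    proof -
      have "card (E `` {v} \<inter> {a, b}) \<le> 1" if "v \<in> T1" for v
      proof -
        have "E `` {v} \<inter> {a, b} \<subseteq> {a} \<or> E `` {v} \<inter> {a, b} \<subseteq> {b}"
          using that E_sym unfolding T1_def by auto
        then show ?thesis
          using card_mono[of "{a}" "E `` {v} \<inter> {a, b}"] card_mono[of "{b}" "E `` {v} \<inter> {a, b}"] by auto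
      qed
      then have "ec T1 {a, b} \<le> (\<Sum>v\<in>T1. 1)"
        unfolding ec_sum[OF fin'(2)] by (rule sum_mono)
      then show ?thesis
        by (simp add: ec_commute)
    qed
    moreover have "ec S' {s, t} \<le> 2 * card S'"
      using ec_prod[of S' "{s, t}"] st fin' by simp
    moreover have "ec S' T2 \<le> 2 * card S'"
    proof -
      have "card (E `` {v} \<inter> T2) \<le> 2" if "v \<in> S'" for v
      proof -
        have "card (E `` {v} \<inter> T2) \<le> card (E `` {a} \<inter> E `` {b} \<inter> E `` {v})"
          by (rule card_mono) (auto simp: T2_def)
        also have "\<dots> \<le> 2"
          using that ab by (intro no_K33) (auto simp: S'_def)
        finally show ?thesis .
      qed
      then have "ec S' T2 \<le> (\<Sum>v\<in>S'. 2)"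
        unfolding ec_sum[OF fin'(1)] by (rule sum_mono)
      then show ?thesis
        by simp
    qed
    moreover have "ec S' T1 \<le> card S' + card T1"
      by (rule coreless_bip, rule coreless_mono[OF cl]) (use ST ab st in \<open>auto simp: S'_def T1_def\<close>)
    ultimately show ?thesis
      using split[of "{a, b}"] split[of S'] cT cS by linarith
  next
    case False
    \<comment> \<open>Now two vertices of \<open>S\<close> share at most one neighbour in
      \<open>T\<close>. The at most four vertices in \<open>SQ\<close> form at most 16 ordered
      pairs, so \<open>T\<close> sends at most \<open>card T + 16\<close> edges to
      \<open>SQ\<close>. The rest of \<open>S\<close> meets \<open>T - Q\<close> in a forest and
      \<open>T \<inter> Q\<close> in at most four edges per vertex.\<close>
    define SQ where "SQ = S \<inter> Q"
    have fSQ: "finite SQ"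
      unfolding SQ_def using fin by auto
    have cSQ: "card SQ \<le> 4"
      using card_mono[of Q SQ] fin Q unfolding SQ_def by auto
    define P where "P = {(a, b). a \<in> SQ \<and> b \<in> SQ \<and> a \<noteq> b}"
    have P: "P \<subseteq> SQ \<times> SQ"
      unfolding P_def by auto
    then have fP: "finite P"
      using fSQ finite_subset by blast
    have "card P \<le> card SQ * card SQ"
      using card_mono[OF _ P] fSQ by (simp add: card_cartesian_product)
    also have "\<dots> \<le> 4 * 4"
      using cSQ by (intro mult_mono) auto
    finally have cP: "card P \<le> 16"
      by simp
    have "ec T SQ = (\<Sum>t\<in>T. card (E `` {t} \<inter> SQ))"
      using fin by (simp add: ec_sum)
    also have "\<dots> \<le> (\<Sum>t\<in>T. 1 + (\<Sum>p\<in>P. if t \<in> E `` {fst p} \<inter> E `` {snd p} then 1 else 0))"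
    proof (rule sum_mono)
      fix t assume "t \<in> T"
      let ?X = "E `` {t} \<inter> SQ"
      have "card ?X \<le> 1 + card {(a, b). a \<in> ?X \<and> b \<in> ?X \<and> a \<noteq> b}"
        by (rule card_le_pairs) simp
      also have "{(a, b). a \<in> ?X \<and> b \<in> ?X \<and> a \<noteq> b} = {p \<in> P. t \<in> E `` {fst p} \<inter> E `` {snd p}}"
        unfolding P_def using E_sym by auto
      also have "card \<dots> = (\<Sum>p\<in>P. if t \<in> E `` {fst p} \<inter> E `` {snd p} then 1 else 0)"
        using fP by (simp only: card_eq_sum sum.inter_filter)
      finally show "card ?X \<le> 1 + (\<Sum>p\<in>P. if t \<in> E `` {fst p} \<inter> E `` {snd p} then 1 else 0)" .
    qed
    also have "\<dots> = card T + (\<Sum>p\<in>P. \<Sum>t\<in>T. if t \<in> E `` {fst p} \<inter> E `` {snd p} then 1 else 0)"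
      unfolding sum.distrib by (subst sum.swap) simp
    also have "(\<Sum>p\<in>P. \<Sum>t\<in>T. if t \<in> E `` {fst p} \<inter> E `` {snd p} then 1 else 0) \<le> (\<Sum>p\<in>P. 1::nat)"
    proof (rule sum_mono)
      fix p assume "p \<in> P"
      moreover define a b where "a = fst p" and "b = snd p"
      ultimately have ab: "a \<in> S" "b \<in> S" "a \<noteq> b"
        unfolding P_def SQ_def by auto
      have "card (T \<inter> (E `` {a} \<inter> E `` {b})) \<le> 1"
      proof (rule ccontr)
        assume "\<not> ?thesis"
        then obtain s t where "s \<in> T \<inter> (E `` {a} \<inter> E `` {b})" "t \<in> T \<inter> (E `` {a} \<inter> E `` {b})" "s \<noteq> t"
          by (metis card_le_Suc0_iff_eq One_nat_def fin(2) finite_Int)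
        then show False
          using False ab by blast
      qed
      moreover have "(\<Sum>t\<in>T. if t \<in> E `` {a} \<inter> E `` {b} then 1 else (0::nat))
          = card (T \<inter> (E `` {a} \<inter> E `` {b}))"
        using fin(2) by (simp only: card_eq_sum sum.inter_restrict)
      ultimately show "(\<Sum>t\<in>T. if t \<in> E `` {fst p} \<inter> E `` {snd p} then 1 else (0::nat)) \<le> 1"
        unfolding a_def b_def by simp
    qed
    finally have 1: "ec T SQ \<le> card T + card P"
      by simp
    have "ec S T \<le> ec SQ T + ec (S - Q) T"
    proof -
      have "S = SQ \<union> (S - Q)"
        unfolding SQ_def by auto
      then show ?thesis
        using ec_Un_left[of SQ "S - Q" T] by simp
    qed
    moreover have "ec (S - Q) T \<le> ec (S - Q) (T \<inter> Q) + ec (S - Q) (T - Q)"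
      using ec_Un_right[of "S - Q" "T \<inter> Q" "T - Q"] by (simp add: Int_Diff_Un)
    moreover have "ec (S - Q) (T - Q) \<le> card (S - Q) + card (T - Q)"
      by (rule coreless_bip, rule coreless_mono[OF coreless_outside_core[OF Q(1)]]) (use ST in auto)
    moreover have "ec (S - Q) (T \<inter> Q) \<le> 4 * card S"
    proof -
      have "ec (S - Q) (T \<inter> Q) \<le> ec S Q"
        by (rule ec_mono) auto
      also have "\<dots> \<le> card S * card Q"
        using fin by (simp add: ec_prod)
      also have "\<dots> \<le> card S * 4"
        using Q by simp
      finally show ?thesis
        by simp
    qed
    moreover have "card (S - Q) \<le> card S" "card (T - Q) \<le> card T"
      using fin by (auto intro: card_mono)
    ultimately show ?thesis
      using 1 cP ec_commute[of SQ T] by linarith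
  qed
qed

end

section \<open>Two vertices of almost full degree\<close>

context sgraph
begin

definition deg :: "'a \<Rightarrow> nat" where
  "deg v = card (E `` {v})"

definition codeg :: "'a \<Rightarrow> 'a \<Rightarrow> nat" where
  "codeg u w = card (E `` {u} \<inter> E `` {w})"

lemma codeg_self: "codeg u u = deg u"
  unfolding codeg_def deg_def by simp

lemma deg_le: "deg v \<le> card V"
  unfolding deg_def by (intro card_mono nb_sub) simp

text \<open>Codegrees are the entries of the squared adjacency matrix, with degrees on the diagonal:
  both sides sum over walks of length two from \<open>u\<close>.\<close>

lemma walks2:
  "(\<Sum>s\<in>E `` {u}. \<Sum>w\<in>E `` {s}. f w) = (\<Sum>w\<in>V. real (codeg u w) * f w)"
proof -
  have "(\<Sum>w\<in>E `` {s}. f w) = (\<Sum>w\<in>V. if s \<in> E `` {w} then f w else 0)" for s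
    by (rule sum.mono_neutral_cong_left) (use nb_sub E_sym in auto)
  then have "(\<Sum>s\<in>E `` {u}. \<Sum>w\<in>E `` {s}. f w)
      = (\<Sum>s\<in>E `` {u}. \<Sum>w\<in>V. if s \<in> E `` {w} then f w else 0)"
    by simp
  also have "\<dots> = (\<Sum>w\<in>V. \<Sum>s\<in>E `` {u}. if s \<in> E `` {w} then f w else 0)"
    by (rule sum.swap)
  also have "\<dots> = (\<Sum>w\<in>V. real (codeg u w) * f w)"
    by (simp add: codeg_def sum.If_cases Int_def)
  finally show ?thesis .
qed

lemma sum_deg: "S \<subseteq> V \<Longrightarrow> (\<Sum>v\<in>S. deg v) = ec S V"
proof -
  assume "S \<subseteq> V"
  then have "finite S"
    by (rule finite_subset) simp
  moreover have "E `` {v} \<inter> V = E `` {v}" for v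
    using nb_sub by auto
  ultimately show ?thesis
    by (simp add: ec_sum deg_def)
qed

end

text \<open>The eigenvector is scaled to have maximum 1, attained at \<open>z\<close>. The bound
  \<open>r_sq\<close> is the squared spectral radius of K_{2,n-2}, a spanning subgraph of the
  extremal graph.\<close>

locale cgraph_eig = cgraph +
  fixes x :: "'a \<Rightarrow> real" and r :: real and z :: 'a
  assumes big: "real (card V) \<ge> 2 * 10 ^ 17"
    and x_nonneg: "\<And>v. v \<in> V \<Longrightarrow> 0 \<le> x v"
    and x_le: "\<And>v. v \<in> V \<Longrightarrow> x v \<le> 1"
    and z: "z \<in> V" "x z = 1"
    and eig: "\<And>v. v \<in> V \<Longrightarrow> (\<Sum>w\<in>E `` {v}. x w) = r * x v"
    and r_sq: "r\<^sup>2 \<ge> 2 * real (card V) - 4"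
    and r_nonneg: "r \<ge> 0"
begin

abbreviation "n \<equiv> real (card V)"

lemma r_large: "r \<ge> 3 * 10 ^ 8"
proof (rule power2_le_imp_le)
  show "(3 * 10 ^ 8)\<^sup>2 \<le> r\<^sup>2"
    using r_sq big by simp
qed (rule r_nonneg)

lemma eig2: "u \<in> V \<Longrightarrow> r\<^sup>2 * x u = (\<Sum>w\<in>V. real (codeg u w) * x w)"
proof -
  assume u: "u \<in> V"
  have "r\<^sup>2 * x u = r * (\<Sum>s\<in>E `` {u}. x s)"
    unfolding eig[OF u] by (simp add: power2_eq_square)
  also have "\<dots> = (\<Sum>s\<in>E `` {u}. \<Sum>w\<in>E `` {s}. x w)"
    unfolding sum_distrib_left by (intro sum.cong refl) (use E_V eig in auto)
  finally show ?thesis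
    unfolding walks2 .
qed

text \<open>If distinct vertices had at most one common neighbour, then in A^2 x - A x at
  \<open>z\<close> the neighbours of \<open>z\<close> would contribute nothing positive and every
  other vertex except \<open>z\<close> at most 1. With deg z from the diagonal this gives r^2 - r <=
  n, incompatible with r^2 >= 2n - 4.\<close>

lemma exists_C4: obtains Q where "core Q" "card Q \<le> 4"
proof -
  have "\<exists>a b. a \<noteq> b \<and> codeg a b \<ge> 2"
  proof (rule ccontr)
    assume "\<not> ?thesis"
    then have cd: "codeg a b \<le> 1" if "a \<noteq> b" for a b
      using that by (metis not_less_eq_eq numeral_2_eq_2 One_nat_def)
    have "r\<^sup>2 - r = (\<Sum>w\<in>V. real (codeg z w) * x w) - (\<Sum>w\<in>E `` {z}. x w)"
      using eig2[OF z(1)] eig[OF z(1)] z(2) by simp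
    also have "(\<Sum>w\<in>E `` {z}. x w) = (\<Sum>w\<in>V. if w \<in> E `` {z} then x w else 0)"
      by (rule sum.mono_neutral_cong_left) (use nb_sub in auto)
    also have "(\<Sum>w\<in>V. real (codeg z w) * x w) - (\<Sum>w\<in>V. if w \<in> E `` {z} then x w else 0)
        = (\<Sum>w\<in>V. real (codeg z w) * x w - (if w \<in> E `` {z} then x w else 0))"
      by (rule sum_subtractf[symmetric])
    also have "\<dots> \<le> (\<Sum>w\<in>V. if w = z then real (deg z) else if w \<in> E `` {z} then 0 else 1)"
    proof (rule sum_mono)
      fix w assume w: "w \<in> V"
      show "real (codeg z w) * x w - (if w \<in> E `` {z} then x w else 0)
          \<le> (if w = z then real (deg z) else if w \<in> E `` {z} then 0 else 1)"
      proof (cases "w = z")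
        case True
        then show ?thesis
          using z by (simp add: codeg_self)
      next
        case False
        then have "real (codeg z w) * x w \<le> 1 * x w"
          using cd[of z w] x_nonneg[OF w] by (intro mult_right_mono) auto
        then show ?thesis
          using False x_le[OF w] by auto
      qed
    qed
    also have "\<dots> = real (deg z) + (\<Sum>w\<in>V - {z}. if w \<in> E `` {z} then 0 else 1)"
      using z(1) by (subst sum.remove[of V z]) (auto intro!: sum.cong)
    also have "(\<Sum>w\<in>V - {z}. if w \<in> E `` {z} then 0 else 1) = real (card (V - {z} - E `` {z}))"
    proof -
      have "V - {z} - E `` {z} = (V - {z}) \<inter> - {w. w \<in> E `` {z}}"
        by auto
      then show ?thesis
        by (simp only: sum.If_cases finite_Diff fin_V) simp
    qed
    also have "card (V - {z} - E `` {z}) = card (V - {z}) - deg z"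
      unfolding deg_def using nb_sub by (intro card_Diff_subset) auto
    also have "card (V - {z}) = card V - 1"
      using z(1) by simp
    also have "real (deg z) + real (card V - 1 - deg z) \<le> n"
      using deg_le[of z] by simp
    finally have "r\<^sup>2 - r \<le> n" .
    then have "r\<^sup>2 \<le> 2 * r + 4"
      using r_sq by simp
    moreover have "r * r \<ge> 3 * 10 ^ 8 * r"
      using r_large by (intro mult_right_mono) auto
    ultimately show False
      using r_large by (simp add: power2_eq_square)
  qed
  then obtain a b where ab: "a \<noteq> b" "codeg a b \<ge> 2"
    by blast
  then obtain T where "T \<subseteq> E `` {a} \<inter> E `` {b}" "card T = 2"
    unfolding codeg_def by (meson obtain_subset_with_card_n)
  then obtain s t where st: "s \<noteq> t" "{s, t} \<subseteq> E `` {a} \<inter> E `` {b}"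
    by (auto simp: card_2_iff)
  have "card {a, b, s, t} \<le> 4"
    by (simp add: card_insert_if)
  then show thesis
    using that core_C4[OF ab(1) st] by blast
qed

text \<open>Total degree is at most 10n, so with this threshold the vertices outside
  \<open>L\<close> contribute at most 10n/1000 to any row of the equation for A^2.\<close>

definition L :: "'a set" where
  "L = {v \<in> V. x v \<ge> 1 / 1000}"

lemma L_V: "L \<subseteq> V" and fin_L [simp]: "finite L"
  unfolding L_def by auto

lemma total_deg: "(\<Sum>v\<in>V. real (deg v)) \<le> 10 * n"
proof -
  obtain Q where Q: "core Q" "card Q \<le> 4"
    by (rule exists_C4)
  then have "ec V V \<le> 10 * card V"
    by (rule edges_linear) simp
  then have "(\<Sum>v\<in>V. deg v) \<le> 10 * card V"
    by (simp add: sum_deg)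
  then show ?thesis
    by (simp flip: of_nat_sum)
qed

text \<open>An entry of at least 1/1000 forces degree at least r/1000, while all degrees sum to at
  most 10n. Hence r |L| <= 10^4 n, and r >= 3 * 10^8 gives the constant. This is where the size of n
  is used most.\<close>

lemma card_L: "30000 * real (card L) \<le> n"
proof -
  have "(\<Sum>v\<in>L. r * (1 / 1000)) \<le> (\<Sum>v\<in>L. real (deg v))"
  proof (rule sum_mono)
    fix v assume "v \<in> L"
    then have v: "v \<in> V" "x v \<ge> 1 / 1000"
      unfolding L_def by auto
    then have "r * (1 / 1000) \<le> r * x v"
      using r_nonneg by (intro mult_left_mono) auto
    also have "\<dots> = (\<Sum>w\<in>E `` {v}. x w)"
      using eig[OF v(1)] by simp
    also have "\<dots> \<le> (\<Sum>w\<in>E `` {v}. 1)"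
      by (rule sum_mono) (use x_le nb_sub in auto)
    finally show "r * (1 / 1000) \<le> real (deg v)"
      by (simp add: deg_def)
  qed
  also have "\<dots> \<le> (\<Sum>v\<in>V. real (deg v))"
    by (rule sum_mono2) (use L_V in auto)
  also have "\<dots> \<le> 10 * n"
    by (rule total_deg)
  finally have "r * real (card L) \<le> 10000 * n"
    by (simp add: mult.commute)
  moreover have "3 * 10 ^ 8 * real (card L) \<le> r * real (card L)"
    using r_large by (intro mult_right_mono) auto
  ultimately show ?thesis
    by simp
qed

text \<open>The edge bound between \<open>insert u L\<close> and the neighbours of \<open>u\<close>
  outside \<open>L\<close> allows two edges per neighbour up to an error. One of them goes to
  \<open>u\<close> itself, so only about one remains for all other vertices of \<open>L\<close>
  together.\<close>

lemma codeg_L: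
  assumes u: "u \<in> V"
  shows "(\<Sum>w\<in>L - {u}. real (codeg u w)) \<le> real (deg u) + n / 1000"
proof -
  obtain Q where Q: "core Q" "card Q \<le> 4"
    by (rule exists_C4)
  let ?N = "E `` {u}"
  let ?T = "?N - L"
  have fT: "finite ?T"
    by simp
  have "(\<Sum>w\<in>L - {u}. codeg u w) = ec (L - {u}) ?N"
    by (simp add: ec_sum codeg_def Int_commute)
  also have "\<dots> \<le> ec (L - {u}) (?N \<inter> L) + ec (L - {u}) ?T"
    using ec_Un_right[of "L - {u}" "?N \<inter> L" ?T] by (simp add: Int_Diff_Un)
  finally have 1: "(\<Sum>w\<in>L - {u}. codeg u w) \<le> ec (L - {u}) (?N \<inter> L) + ec (L - {u}) ?T" .
  have 2: "ec (L - {u}) (?N \<inter> L) \<le> 10 * card L"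
    using ec_mono[of "L - {u}" L "?N \<inter> L" L] edges_linear[OF Q L_V] by auto
  have "ec {u} ?T = card ?T"
    by (simp add: ec_sum Int_absorb1)
  moreover have "ec (L - {u}) ?T + ec {u} ?T \<le> ec (insert u L) ?T"
    unfolding ec_def by (subst card_Un_disjoint[symmetric]) (auto intro!: card_mono)
  moreover have "ec (insert u L) ?T \<le> 2 * card ?T + 5 * card (insert u L) + 16"
    by (rule bipartite_edges[OF Q]) (use u L_V nb_sub in auto)
  moreover have "card (insert u L) \<le> Suc (card L)"
    by (simp add: card_insert_if)
  moreover have "card ?T \<le> deg u"
    unfolding deg_def by (intro card_mono) auto
  \<comment> \<open>15 is 10 from the edges inside \<open>L\<close> plus 5 from
    \<open>bipartite_edges\<close>; 21 is 16 plus another 5 for the extra vertex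
    \<open>u\<close>.\<close>
  ultimately have "(\<Sum>w\<in>L - {u}. codeg u w) \<le> deg u + 15 * card L + 21"
    using 1 2 by linarith
  then have "real (\<Sum>w\<in>L - {u}. codeg u w) \<le> real (deg u + 15 * card L + 21)"
    by (rule of_nat_mono)
  then show ?thesis
    using card_L big by simp
qed

text \<open>Row \<open>u\<close> of the equation for A^2, split into the diagonal, the large entries
  and the rest. The codegrees of \<open>u\<close> sum to the degrees of its neighbours, hence to at
  most 10n, and the rest carries weights below 1/1000.\<close>

lemma eig2_L:
  assumes u: "u \<in> V"
  shows "r\<^sup>2 * x u \<le> real (deg u) * x u + (\<Sum>w\<in>L - {u}. real (codeg u w) * x w) + n / 100"
proof -
  have V: "V = {u} \<union> ((L - {u}) \<union> (V - L - {u}))"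
    using u L_V by auto
  have "r\<^sup>2 * x u = real (codeg u u) * x u + ((\<Sum>w\<in>L - {u}. real (codeg u w) * x w)
      + (\<Sum>w\<in>V - L - {u}. real (codeg u w) * x w))"
    unfolding eig2[OF u]
    by (subst V, subst sum.union_disjoint; (subst sum.union_disjoint)?) auto
  moreover have "(\<Sum>w\<in>V - L - {u}. real (codeg u w) * x w) \<le> n / 100"
  proof -
    have "(\<Sum>w\<in>V - L - {u}. real (codeg u w) * x w) \<le> (\<Sum>w\<in>V - L - {u}. real (codeg u w) * (1 / 1000))"
      by (intro sum_mono mult_left_mono) (auto simp: L_def)
    also have "\<dots> \<le> (\<Sum>w\<in>V. real (codeg u w) * (1 / 1000))"
      by (intro sum_mono2) auto
    also have "\<dots> = (\<Sum>w\<in>V. real (codeg u w) * 1) / 1000"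
      by (simp add: sum_divide_distrib)
    also have "(\<Sum>w\<in>V. real (codeg u w) * 1) = (\<Sum>s\<in>E `` {u}. real (deg s))"
      unfolding walks2[symmetric] by (simp add: deg_def)
    also have "\<dots> \<le> (\<Sum>s\<in>V. real (deg s))"
      by (intro sum_mono2) (use nb_sub in auto)
    finally show ?thesis
      using total_deg by simp
  qed
  ultimately show ?thesis
    by (simp add: codeg_self)
qed

text \<open>Used in both directions: a large entry forces a large degree, and a small degree forces
  a small entry.\<close>

lemma deg_lower:
  assumes u: "u \<in> V"
  shows "r\<^sup>2 * x u \<le> 2 * real (deg u) + 11 * n / 1000"
proof -
  have "(\<Sum>w\<in>L - {u}. real (codeg u w) * x w) \<le> (\<Sum>w\<in>L - {u}. real (codeg u w) * 1)"
    by (intro sum_mono mult_left_mono) (use x_le L_V in auto)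
  moreover have "real (deg u) * x u \<le> real (deg u) * 1"
    by (intro mult_left_mono) (use x_le u in auto)
  ultimately show ?thesis
    using eig2_L[OF u] codeg_L[OF u] by simp
qed

text \<open>At \<open>z\<close> the degree must exceed 0.994 n. If all other large entries were at
  most 0.98, row \<open>z\<close> would give 2n - 4 <= n + 0.98 * 1.001 n + 0.01 n, which is false.
  So \<open>w\<close> exists, has degree at least 0.97 n, and shares at least 0.964 n neighbours
  with \<open>z\<close>.\<close>

lemma two_hubs:
  obtains w where "w \<in> V" "w \<noteq> z" "x w \<ge> 98 / 100"
    "real (card (E `` {z} \<inter> E `` {w})) \<ge> 96 * n / 100"
    "\<And>v. v \<in> V \<Longrightarrow> v \<noteq> z \<Longrightarrow> v \<noteq> w \<Longrightarrow> x v \<le> 5 / 100"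
proof -
  have dz: "1000 * real (deg z) \<ge> 994 * n"
    using deg_lower[OF z(1)] r_sq z(2) big by simp
  have dz': "real (deg z) \<le> n"
    using deg_le[of z] by simp
  have "\<exists>w\<in>L - {z}. x w \<ge> 98 / 100"
  proof (rule ccontr)
    assume "\<not> ?thesis"
    then have "x w \<le> 98 / 100" if "w \<in> L - {z}" for w
      using that by (meson less_imp_le not_le)
    then have "(\<Sum>w\<in>L - {z}. real (codeg z w) * x w) \<le> (\<Sum>w\<in>L - {z}. real (codeg z w) * (98 / 100))"
      by (intro sum_mono mult_left_mono) auto
    also have "\<dots> = (\<Sum>w\<in>L - {z}. real (codeg z w)) * (98 / 100)"
      by (rule sum_distrib_right[symmetric])
    also have "\<dots> \<le> (real (deg z) + n / 1000) * (98 / 100)"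
      by (intro mult_right_mono codeg_L z) simp
    finally show False
      using eig2_L[OF z(1)] r_sq z(2) big dz' by simp
  qed
  then obtain w where w: "w \<in> V" "w \<noteq> z" "x w \<ge> 98 / 100"
    unfolding L_def by auto
  have "(2 * n - 4) * (98 / 100) \<le> r\<^sup>2 * x w"
    using r_sq w(3) big by (intro mult_mono) auto
  then have dw: "100 * real (deg w) \<ge> 97 * n"
    using deg_lower[OF w(1)] big by simp
  let ?D = "E `` {z} \<inter> E `` {w}"
  have "card (E `` {z} \<union> E `` {w}) + card ?D = deg z + deg w"
    unfolding deg_def by (rule card_Un_Int[symmetric]) auto
  moreover have "card (E `` {z} \<union> E `` {w}) \<le> card V"
    by (intro card_mono) (use nb_sub in auto)
  ultimately have "deg z + deg w \<le> card V + card ?D"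
    by linarith
  then have "real (deg z) + real (deg w) \<le> n + real (card ?D)"
    by linarith
  then have D: "1000 * real (card ?D) \<ge> 964 * n"
    using dz dw by simp
  \<comment> \<open>A third vertex has at most two neighbours among the common neighbours of
    \<open>z\<close> and \<open>w\<close>, so its degree is at most 0.036 n + 2. By
    \<open>deg_lower\<close> its entry is then below 0.05.\<close>
  have "x v \<le> 5 / 100" if v: "v \<in> V" "v \<noteq> z" "v \<noteq> w" for v
  proof -
    have DV: "?D \<subseteq> V"
      using nb_sub by auto
    have "deg v \<le> card (?D \<inter> E `` {v} \<union> (V - ?D))"
      unfolding deg_def by (intro card_mono) (use nb_sub in auto)
    also have "\<dots> \<le> card (?D \<inter> E `` {v}) + card (V - ?D)"
      by (rule card_Un_le)
    also have "card (?D \<inter> E `` {v}) \<le> 2"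
      by (rule no_K33) (use v w in auto)
    also have "card (V - ?D) = card V - card ?D"
      by (rule card_Diff_subset) (use DV in auto)
    finally have "deg v \<le> 2 + (card V - card ?D)"
      by simp
    moreover have "card ?D \<le> card V"
      using DV by (simp add: card_mono)
    ultimately have "real (deg v) \<le> 2 + n - real (card ?D)"
      by linarith
    then have "r\<^sup>2 * x v \<le> 90 * n / 1000"
      using deg_lower[OF v(1)] D big by simp
    moreover have "r\<^sup>2 * x v \<ge> (2 * n - 4) * x v"
      using r_sq x_nonneg[OF v(1)] by (intro mult_right_mono) auto
    ultimately have "(2 * n - 4) * x v \<le> 90 * n / 1000"
      by linarith
    show ?thesis
    proof (rule ccontr)
      assume "\<not> ?thesis"
      then have "(2 * n - 4) * (5 / 100) \<le> (2 * n - 4) * x v"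
        using big by (intro mult_left_mono) auto
      then show False
        using \<open>(2 * n - 4) * x v \<le> 90 * n / 1000\<close> big by simp
    qed
  qed
  then show thesis
    using that[OF w] D by auto
qed

end

section \<open>Comparison with the extremal graph\<close>

text \<open>The arcs of \<open>K\<^sub>2 + (P\<^sub>3 \<union> m K\<^sub>1)\<close> on \<open>V\<close>, where \<open>u, v\<close> span \<open>K\<^sub>2\<close> and \<open>P\<^sub>3\<close> is \<open>a, b, c\<close>.\<close>

definition k2p3_arcs :: "'a set \<Rightarrow> 'a \<Rightarrow> 'a \<Rightarrow> 'a \<Rightarrow> 'a \<Rightarrow> 'a \<Rightarrow> ('a \<times> 'a) set" where
  "k2p3_arcs V u v a b c = {(p, q). p \<in> V \<and> q \<in> V \<and> p \<noteq> q \<and>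
    (p \<in> {u, v} \<or> q \<in> {u, v} \<or> {p, q} = {a, b} \<or> {p, q} = {b, c})}"

lemma sgraph_k2p3: "finite V \<Longrightarrow> sgraph V (k2p3_arcs V u v a b c)"
  by unfold_locales (auto simp: k2p3_arcs_def insert_commute)

context cgraph
begin

text \<open>Disjoint edges inside \<open>D\<close> would complete to disjoint triangles, one through
  \<open>z\<close> and one through \<open>w\<close>, so all edges inside \<open>D\<close> meet
  pairwise. A triangle is excluded by a 4-cycle through \<open>z\<close> and \<open>w\<close>, and a
  vertex with three neighbours in \<open>D\<close> by K_{3,3}. What survives has at most two edges,
  sharing a vertex.\<close>

lemma edges_between_hubs:
  assumes zw: "z \<noteq> w" and D: "D = E `` {z} \<inter> E `` {w}" "5 \<le> card D"
  obtains a b c where "distinct [a, b, c]" "{a, b, c} \<subseteq> D"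
    "E \<inter> D \<times> D \<subseteq> {(a, b), (b, a), (b, c), (c, b)}"
proof -
  have finD: "finite D"
    unfolding D by simp
  have zwD: "z \<notin> D" "w \<notin> D"
    unfolding D by auto
  have disj: "{p, q} \<inter> {s, t} \<noteq> {}" if pq: "(p, q) \<in> E \<inter> D \<times> D" and st: "(s, t) \<in> E \<inter> D \<times> D" for p q s t
  proof
    assume *: "{p, q} \<inter> {s, t} = {}"
    have "core {z, p, q}" "core {w, s, t}"
      by (rule core_C3; use pq st in \<open>auto simp: D\<close>)+
    then have "{z, p, q} \<inter> {w, s, t} \<noteq> {}"
      by (rule no_disjoint_cores)
    then show False
      using * zw pq st zwD by auto
  qed
  have ex: "\<exists>d\<in>D. d \<notin> X" if "card X < 5" "finite X" for X
    using that D(2) finD by (metis card_mono leD order_trans subsetI not_le)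
  \<comment> \<open>Here \<open>5 <= card D\<close> enters: besides the triangle, \<open>D\<close>
    must contain two more vertices to form a 4-cycle with \<open>z\<close> and
    \<open>w\<close>.\<close>
  have tri: False if "(p, q) \<in> E" "(q, s) \<in> E" "(p, s) \<in> E" "{p, q, s} \<subseteq> D" for p q s
  proof -
    have c3: "card {p, q, s} \<le> 3"
      by (simp add: card_insert_if)
    obtain d where d: "d \<in> D" "d \<notin> {p, q, s}"
      using ex[of "{p, q, s}"] c3 by auto
    obtain d' where d': "d' \<in> D" "d' \<notin> insert d {p, q, s}"
      using ex[of "insert d {p, q, s}"] c3 d by (auto simp: card_insert_if)
    have "core {z, w, d, d'}"
      by (rule core_C4) (use zw d d' in \<open>auto simp: D\<close>)
    then have "{z, w, d, d'} \<inter> {p, q, s} \<noteq> {}"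
      using core_C3[OF that(1-3)] by (rule no_disjoint_cores)
    then show False
      using d d' zwD that(4) by auto
  qed
  show thesis
  proof (cases "\<exists>b\<in>D. \<exists>a\<in>D. \<exists>c\<in>D. a \<noteq> c \<and> (b, a) \<in> E \<and> (b, c) \<in> E")
    case True
    then obtain a b c where abc: "a \<in> D" "b \<in> D" "c \<in> D" "a \<noteq> c" "(b, a) \<in> E" "(b, c) \<in> E"
      by blast
    have ne: "a \<noteq> b" "b \<noteq> c"
      using abc by auto
    have nb: "t = a \<or> t = c" if "(b, t) \<in> E" "t \<in> D" for t
    proof (rule ccontr)
      assume "\<not> ?thesis"
      then have "card {a, c, t} = 3"
        using abc by auto
      moreover have "{a, c, t} \<subseteq> E `` {z} \<inter> E `` {w} \<inter> E `` {b}"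
        using abc that unfolding D by auto
      ultimately have "3 \<le> card (E `` {z} \<inter> E `` {w} \<inter> E `` {b})"
        by (metis card_mono fin_nb finite_Int)
      moreover have "card (E `` {z} \<inter> E `` {w} \<inter> E `` {b}) \<le> 2"
        by (rule no_K33) (use zw zwD abc in auto)
      ultimately show False
        by simp
    qed
    have "(s, t) \<in> {(a, b), (b, a), (b, c), (c, b)}" if st: "(s, t) \<in> E \<inter> D \<times> D" for s t
    proof (cases "s = b \<or> t = b")
      case True
      then show ?thesis
        using nb[of s] nb[of t] st E_sym by auto
    next
      case False
      then have "a \<in> {s, t}" "c \<in> {s, t}"
        using disj[of b a s t] disj[of b c s t] abc st by auto
      then have "(a, c) \<in> E"
        using abc st E_sym by auto
      then show ?thesis
        using tri[of a b c] abc E_sym by auto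
    qed
    then show thesis
      using that[of a b c] abc ne by auto
  next
    case False
    then have uniq: "t = t'" if "(s, t) \<in> E" "(s, t') \<in> E" "s \<in> D" "t \<in> D" "t' \<in> D" for s t t'
      using that by blast
    have "\<exists>a b. a \<in> D \<and> b \<in> D \<and> a \<noteq> b \<and> E \<inter> D \<times> D \<subseteq> {(a, b), (b, a)}"
    proof (cases "E \<inter> D \<times> D = {}")
      case True
      obtain a where a: "a \<in> D"
        using ex[of "{}"] by auto
      obtain b where "b \<in> D" "b \<notin> {a}"
        using ex[of "{a}"] by auto
      then show ?thesis
        using a True by auto
    next
      case False
      then obtain a b where ab: "(a, b) \<in> E" "a \<in> D" "b \<in> D"
        by auto
      have "(s, t) \<in> {(a, b), (b, a)}" if st: "(s, t) \<in> E \<inter> D \<times> D" for s t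
      proof -
        have "{a, b} \<inter> {s, t} \<noteq> {}"
          using disj[of a b s t] ab st by auto
        then consider "s = a" | "s = b" | "t = a" | "t = b"
          by auto
        then show ?thesis
        proof cases
          case 1 then show ?thesis using uniq[of a t b] ab st by auto
        next
          case 2 then show ?thesis using uniq[of b t a] ab st E_sym by auto
        next
          case 3 then show ?thesis using uniq[of a s b] ab st E_sym by auto
        next
          case 4 then show ?thesis using uniq[of b s a] ab st E_sym by auto
        qed
      qed
      moreover have "a \<noteq> b"
        using ab by auto
      ultimately show ?thesis
        using ab by (intro exI[of _ a] exI[of _ b]) auto
    qed
    then obtain a b where ab: "a \<in> D" "b \<in> D" "a \<noteq> b" "E \<inter> D \<times> D \<subseteq> {(a, b), (b, a)}"
      by (elim exE conjE)
    obtain c where c: "c \<in> D" "c \<notin> {a, b}"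
      using ex[of "{a, b}"] ab(3) by auto
    show thesis
      by (rule that[of a b c]) (use ab c in auto)
  qed
qed

end

context cgraph_eig
begin

text \<open>The competitor and the extremal graph are compared at the same vector \<open>x\<close>.
  Passing from \<open>E\<close> to \<open>E2\<close> loses weight at most 0.3 s and gains at least
  0.98 s, where s is the sum of the entries on \<open>R\<close>. Since \<open>r2 <= r\<close>, a
  gain is impossible; this yields s = 0 and equality throughout, from which \<open>R = {}\<close>
  and \<open>E = E2\<close> follow by positivity.\<close>

theorem unique_maximum:
  assumes ray: "\<And>u v a b c y. distinct [u, v, a, b, c] \<Longrightarrow> {u, v, a, b, c} \<subseteq> V \<Longrightarrow>
      sgraph.qf (k2p3_arcs V u v a b c) y \<le> r2 * sq y"
    and r2: "r2 \<le> r"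
  obtains u v a b c where "distinct [u, v, a, b, c]" "{u, v, a, b, c} \<subseteq> V" "E = k2p3_arcs V u v a b c"
proof -
  obtain w where w: "w \<in> V" "w \<noteq> z" "x w \<ge> 98 / 100"
    and cD: "real (card (E `` {z} \<inter> E `` {w})) \<ge> 96 * n / 100"
    and small: "\<And>v. v \<in> V \<Longrightarrow> v \<noteq> z \<Longrightarrow> v \<noteq> w \<Longrightarrow> x v \<le> 5 / 100"
    by (rule two_hubs) (rule that; assumption)
  define D where "D = E `` {z} \<inter> E `` {w}"
  define R where "R = V - D - {z, w}"
  have zwD: "z \<notin> D" "w \<notin> D"
    unfolding D_def by auto
  have DV: "D \<subseteq> V"
    unfolding D_def using nb_sub by auto
  have finR: "finite R" and RV: "R \<subseteq> V"
    unfolding R_def by auto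
  have Vdec: "v \<in> {z, w} \<or> v \<in> D \<or> v \<in> R" if "v \<in> V" for v
    using that unfolding R_def by auto
  have "5 \<le> real (card D)"
    using cD big unfolding D_def by simp
  then have D5: "5 \<le> card D"
    by simp
  obtain a b c where abc: "distinct [a, b, c]" "{a, b, c} \<subseteq> D"
    and ED: "E \<inter> D \<times> D \<subseteq> {(a, b), (b, a), (b, c), (c, b)}"
    by (rule edges_between_hubs[OF w(2)[symmetric] D_def D5])
  define E2 where "E2 = k2p3_arcs V z w a b c"
  interpret H: sgraph V E2
    unfolding E2_def by (rule sgraph_k2p3) simp
  have dist: "distinct [z, w, a, b, c]" "{z, w, a, b, c} \<subseteq> V"
    using abc zwD w z DV by auto
  have ray2: "H.qf y \<le> r2 * H.sq y" for y
    using ray[OF dist, of y] unfolding E2_def .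
  have corelessR: "coreless R"
  proof -
    obtain T where "T \<subseteq> D" "card T = 2"
      using obtain_subset_with_card_n[of 2 D] D5 by auto
    then obtain d d' where d: "d \<in> D" "d' \<in> D" "d \<noteq> d'"
      by (auto simp: card_2_iff)
    have "core {z, w, d, d'}"
      by (rule core_C4) (use w d in \<open>auto simp: D_def\<close>)
    then show ?thesis
      by (rule coreless_mono[OF coreless_outside_core]) (use d in \<open>auto simp: R_def\<close>)
  qed
  let ?f = "\<lambda>p. x (fst p) * x (snd p)"
  have f_nonneg: "?f p \<ge> 0" if "p \<in> V \<times> V" for p
    using that x_nonneg by auto
  define s where "s = (\<Sum>v\<in>R. x v)"
  have s_nonneg: "s \<ge> 0"
    unfolding s_def by (intro sum_nonneg) (use x_nonneg RV in auto)
  have smallR: "0 \<le> x v \<and> x v \<le> 5 / 100" if "v \<in> R \<union> D" for v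
    using that small x_nonneg RV DV zwD unfolding R_def by auto
  have RR: "(\<Sum>p\<in>E \<inter> R \<times> R. ?f p) \<le> 10 / 100 * s"
    using coreless_weight[OF corelessR, of x "5 / 100"] smallR by (simp add: s_def split_def)
  have RD: "(\<Sum>p\<in>E \<inter> R \<times> D. ?f p) \<le> 10 / 100 * s"
  proof -
    have "E \<inter> R \<times> D = Sigma R (\<lambda>v. E `` {v} \<inter> D)"
      by auto
    then have "(\<Sum>p\<in>E \<inter> R \<times> D. ?f p) = (\<Sum>v\<in>R. \<Sum>d\<in>E `` {v} \<inter> D. x v * x d)"
      using finR by (simp add: sum.Sigma split_def)
    also have "\<dots> \<le> (\<Sum>v\<in>R. 10 / 100 * x v)"
    proof (rule sum_mono)
      fix v assume v: "v \<in> R"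
      have "card (E `` {z} \<inter> E `` {w} \<inter> E `` {v}) \<le> 2"
        by (rule no_K33) (use v w in \<open>auto simp: R_def\<close>)
      then have c2: "real (card (E `` {v} \<inter> D)) \<le> 2"
        unfolding D_def by (simp add: Int_commute)
      have "(\<Sum>d\<in>E `` {v} \<inter> D. x v * x d) \<le> (\<Sum>d\<in>E `` {v} \<inter> D. x v * (5 / 100))"
        by (intro sum_mono mult_left_mono) (use smallR v in auto)
      also have "\<dots> = real (card (E `` {v} \<inter> D)) * (x v * (5 / 100))"
        by simp
      also have "\<dots> \<le> 2 * (x v * (5 / 100))"
        by (intro mult_right_mono c2) (use smallR v in auto)
      finally show "(\<Sum>d\<in>E `` {v} \<inter> D. x v * x d) \<le> 10 / 100 * x v"
        by simp
    qed
    finally show ?thesis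
      by (simp add: s_def sum_distrib_left)
  qed
  have DR: "(\<Sum>p\<in>E \<inter> D \<times> R. ?f p) = (\<Sum>p\<in>E \<inter> R \<times> D. ?f p)"
    by (rule sum.reindex_bij_witness[of _ prod.swap prod.swap]) (auto intro: E_sym)
  have lost_sub: "E - E2 \<subseteq> (E \<inter> R \<times> R) \<union> (E \<inter> R \<times> D) \<union> (E \<inter> D \<times> R)"
  proof
    fix p assume p: "p \<in> E - E2"
    obtain i j where ij: "p = (i, j)"
      by fastforce
    have e: "(i, j) \<in> E" "i \<in> V" "j \<in> V" "i \<noteq> j"
      using p ij E_V by auto
    then have "i \<notin> {z, w}" "j \<notin> {z, w}" "{i, j} \<noteq> {a, b}" "{i, j} \<noteq> {b, c}"
      using p ij unfolding E2_def k2p3_arcs_def by auto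
    moreover from this have "\<not> (i \<in> D \<and> j \<in> D)"
      using ED e(1) by (auto simp: insert_commute)
    ultimately show "p \<in> (E \<inter> R \<times> R) \<union> (E \<inter> R \<times> D) \<union> (E \<inter> D \<times> R)"
      using e Vdec[of i] Vdec[of j] ij by auto
  qed
  \<comment> \<open>Three blocks lose at most 0.1 s each: arcs inside the forest on
    \<open>R\<close>, and arcs between \<open>R\<close> and \<open>D\<close> in either orientation,
    where a vertex of \<open>R\<close> has at most two neighbours in \<open>D\<close> with entries
    at most 0.05.\<close>
  have lost: "(\<Sum>p\<in>E - E2. ?f p) \<le> 30 / 100 * s"
  proof -
    have "(\<Sum>p\<in>E - E2. ?f p) \<le> (\<Sum>p\<in>(E \<inter> R \<times> R) \<union> (E \<inter> R \<times> D) \<union> (E \<inter> D \<times> R). ?f p)"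
      using lost_sub by (intro sum_mono2 f_nonneg) (use E_sub in auto)
    also have "\<dots> = (\<Sum>p\<in>E \<inter> R \<times> R. ?f p) + (\<Sum>p\<in>E \<inter> R \<times> D. ?f p) + (\<Sum>p\<in>E \<inter> D \<times> R. ?f p)"
      by (subst sum.union_disjoint; (subst sum.union_disjoint)?) (auto simp: R_def)
    finally show ?thesis
      using RR RD DR by simp
  qed
  have gain: "(\<Sum>p\<in>E2 - E. ?f p) \<ge> 98 / 100 * s"
  proof -
    \<comment> \<open>A hub that \<open>v\<close> misses; it exists because \<open>v\<close> is not
      a common neighbour of \<open>z\<close> and \<open>w\<close>. Counting the new arc in one
      orientation is enough.\<close>
    define h where "h v = (if (v, z) \<in> E then w else z)" for v
    have h: "(v, h v) \<in> E2 - E" "x (h v) \<ge> 98 / 100" if "v \<in> R" for v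
    proof -
      have "v \<in> V" "v \<noteq> z" "v \<noteq> w" "\<not> ((v, z) \<in> E \<and> (v, w) \<in> E)"
        using that E_sym unfolding R_def D_def by auto
      then show "(v, h v) \<in> E2 - E"
        using z w unfolding h_def E2_def k2p3_arcs_def by auto
      show "x (h v) \<ge> 98 / 100"
        using z w unfolding h_def by simp
    qed
    have "98 / 100 * s = (\<Sum>v\<in>R. x v * (98 / 100))"
      unfolding s_def sum_distrib_right[symmetric] by simp
    also have "\<dots> \<le> (\<Sum>v\<in>R. x v * x (h v))"
      by (intro sum_mono mult_left_mono) (use h smallR in auto)
    also have "\<dots> = (\<Sum>p\<in>(\<lambda>v. (v, h v)) ` R. ?f p)"
      by (subst sum.reindex) (auto simp: inj_on_def)
    also have "\<dots> \<le> (\<Sum>p\<in>E2 - E. ?f p)"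
      by (intro sum_mono2 f_nonneg) (use h H.E_sub in auto)
    finally show ?thesis .
  qed
  have qf_split: "qf x = (\<Sum>p\<in>E \<inter> E2. ?f p) + (\<Sum>p\<in>E - E2. ?f p)"
    "H.qf x = (\<Sum>p\<in>E \<inter> E2. ?f p) + (\<Sum>p\<in>E2 - E. ?f p)"
    unfolding qf_def H.qf_def split_def
    using sum.Int_Diff[of E ?f E2] sum.Int_Diff[of E2 ?f E] by (auto simp: Int_commute)
  have qfx: "qf x = r * sq x"
    unfolding qf_eq sq_def sum_distrib_left
    by (intro sum.cong refl) (simp add: eig sum_distrib_left[symmetric] power2_eq_square)
  have sqpos: "sq x > 0"
  proof -
    have "(x z)\<^sup>2 \<le> sq x"
      unfolding sq_def by (rule member_le_sum) (use z in auto)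
    then show ?thesis
      using z by simp
  qed
  have up: "H.qf x \<le> qf x"
  proof -
    have "r2 * sq x \<le> r * sq x"
      using r2 sqpos by simp
    then show ?thesis
      using ray2[of x] unfolding qfx by linarith
  qed
  then have s0: "s = 0"
    using lost gain qf_split s_nonneg by linarith
  then have "H.qf x = qf x"
    using up lost gain qf_split by linarith
  then have "r * sq x \<le> r2 * sq x"
    using ray2[of x] unfolding qfx by simp
  then have "r = r2"
    using r2 sqpos by simp
  then have eq2: "H.qf x = r2 * H.sq x"
    using \<open>H.qf x = qf x\<close> unfolding qfx by simp
  \<comment> \<open>Equality turns \<open>x\<close> into an eigenvector for \<open>E2\<close>. There
    \<open>v\<close> is adjacent to \<open>z\<close>, so the neighbours of \<open>v\<close> sum to
    at least \<open>x z = 1\<close> and \<open>x v\<close> cannot vanish.\<close>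
  have pos: "x v > 0" if v: "v \<in> V" for v
  proof (cases "v = z")
    case False
    have "(v, z) \<in> E2"
      using v z(1) False unfolding E2_def k2p3_arcs_def by simp
    moreover have "0 \<le> x u" if "u \<in> E2 `` {v}" for u
      using that H.nb_sub[of "{v}"] by (intro x_nonneg) blast
    ultimately have "x z \<le> (\<Sum>u\<in>E2 `` {v}. x u)"
      by (intro member_le_sum) simp_all
    also have "\<dots> = r2 * x v"
      by (rule H.rayleigh_equality[OF ray2 eq2 v])
    finally have "x v \<noteq> 0"
      using z by auto
    then show ?thesis
      using x_nonneg[OF v] by simp
  qed (use z in simp)
  have "R = {}"
  proof (rule ccontr)
    assume "R \<noteq> {}"
    then have "s > 0"
      unfolding s_def using pos RV finR by (intro sum_pos) auto
    then show False
      using s0 by simp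
  qed
  then have sub: "E \<subseteq> E2"
    using lost_sub by auto
  have "E2 - E = {}"
  proof (rule ccontr)
    assume ne: "E2 - E \<noteq> {}"
    have "?f p > 0" if "p \<in> E2 - E" for p
      using that H.E_sub pos by auto
    then have "(\<Sum>p\<in>E2 - E. ?f p) > 0"
      using ne by (intro sum_pos) simp_all
    moreover have "(\<Sum>p\<in>E - E2. ?f p) = 0"
      using sub by (intro sum.neutral) blast
    ultimately show False
      using qf_split \<open>H.qf x = qf x\<close> by linarith
  qed
  then have "E = E2"
    using sub by auto
  then show thesis
    using that[OF dist] unfolding E2_def by simp
qed

end

section \<open>Isomorphisms, copies and cycles\<close>

lemma sgraph_pair_graph: "sgraph V E \<Longrightarrow> pair_graph \<lparr>pverts = V, parcs = E\<rparr>"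
proof -
  assume "sgraph V E"
  then interpret sgraph V E .
  show ?thesis
    by unfold_locales (use E_V E_sym fin_E fin_V in \<open>auto simp: symmetric_def sym_def\<close>)
qed

lemma pair_graph_iff_sgraph: "pair_graph G \<longleftrightarrow> sgraph (pverts G) (parcs G)"
proof
  assume "sgraph (pverts G) (parcs G)"
  from sgraph_pair_graph[OF this] show "pair_graph G"
    by (metis (full_types) pair_pre_digraph.surjective old.unit.exhaust)
qed (rule pair_graph_sgraph)

lemma graph_isoI:
  assumes G: "pair_graph G" and f: "inj_on f (pverts G)" "pverts H = f ` pverts G"
    "parcs H = map_prod f f ` parcs G"
  shows "graph_iso G H"
proof -
  interpret pair_graph G
    by (rule G)
  define h where "h = \<lparr>iso_verts = f, iso_arcs = map_prod f f, iso_head = snd, iso_tail = fst\<rparr>"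
  have "inj_on (map_prod f f) (parcs G)"
    by (rule inj_on_subset[OF map_prod_inj_on[OF f(1) f(1)]]) (use in_arcsD1 in_arcsD2 in auto)
  then have "pre_digraph.digraph_isomorphism (with_proj G) h"
    unfolding pre_digraph.digraph_isomorphism_def h_def
    using f(1) wf_digraph_axioms by auto
  moreover have "with_proj H = app_iso h (with_proj G)"
    unfolding with_proj_def app_iso_def h_def using f(2,3) by simp
  ultimately show ?thesis
    unfolding graph_iso_def digraph_iso_def by blast
qed

lemma graph_isoE:
  assumes "graph_iso G H"
  obtains f where "inj_on f (pverts G)" "pverts H = f ` pverts G" "parcs H = map_prod f f ` parcs G"
proof -
  obtain h where h: "pre_digraph.digraph_isomorphism (with_proj G) h"
    "with_proj H = app_iso h (with_proj G)"
    using assms unfolding graph_iso_def digraph_iso_def by blast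
  from h(2) have H: "pverts H = iso_verts h ` pverts G" "parcs H = iso_arcs h ` parcs G"
    "iso_tail h = fst" "iso_head h = snd"
    by (simp_all add: with_proj_def app_iso_def)
  have "iso_arcs h e = map_prod (iso_verts h) (iso_verts h) e" if "e \<in> parcs G" for e
    using h(1) that H(3,4) unfolding pre_digraph.digraph_isomorphism_def
    by (auto intro!: prod_eqI)
  then have "parcs H = map_prod (iso_verts h) (iso_verts h) ` parcs G"
    unfolding H(2) by (rule image_cong[OF refl])
  moreover have "inj_on (iso_verts h) (pverts G)"
    using h(1) unfolding pre_digraph.digraph_isomorphism_def by simp
  ultimately show thesis
    using that H(1) by blast
qed

lemma graph_iso_sym: "pair_graph G \<Longrightarrow> graph_iso G H \<Longrightarrow> graph_iso H G"
  unfolding graph_iso_def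
proof (rule digraph_iso_swap)
  assume "pair_graph G"
  then interpret pair_graph G .
  show "wf_digraph (with_proj G)"
    by (rule wf_digraph_axioms)
qed

lemma graph_iso_trans: "graph_iso G H \<Longrightarrow> graph_iso H K \<Longrightarrow> graph_iso G K"
  unfolding graph_iso_def by (rule digraph_iso_trans)

text \<open>The radius is defined through a chosen vertex ordering. Carrying a maximising vector
  along the isomorphism avoids comparing the two orderings.\<close>

lemma graph_iso_spectral_radius_le:
  assumes G: "pair_graph G" "pair_graph H" "pverts G \<noteq> {}" and iso: "graph_iso G H"
  shows "graph_spectral_radius G \<le> graph_spectral_radius H"
proof -
  interpret G: sgraph "pverts G" "parcs G"
    by (rule pair_graph_sgraph[OF G(1)])
  interpret H: sgraph "pverts H" "parcs H"
    by (rule pair_graph_sgraph[OF G(2)])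
  obtain f where f: "inj_on f (pverts G)" "pverts H = f ` pverts G" "parcs H = map_prod f f ` parcs G"
    using iso by (rule graph_isoE)
  obtain x where x: "G.sq x = 1"
    "\<And>v. v \<in> pverts G \<Longrightarrow> (\<Sum>w\<in>parcs G `` {v}. x w) = graph_spectral_radius G * x v"
    by (rule spectral_radius_rayleigh[OF G(1,3)]) (rule that; assumption)
  have "pverts H \<noteq> {}"
    using G(3) f(2) by simp
  then have ray: "H.qf y \<le> graph_spectral_radius H * H.sq y" for y
    by (rule spectral_radius_rayleigh[OF G(2)])
  define y where "y v = x (the_inv_into (pverts G) f v)" for v
  have y: "y (f v) = x v" if "v \<in> pverts G" for v
    unfolding y_def using f(1) that by (simp add: the_inv_into_f_f)
  have inj2: "inj_on (map_prod f f) (parcs G)"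
    by (rule inj_on_subset[OF map_prod_inj_on[OF f(1) f(1)] G.E_sub])
  have "H.qf y = (\<Sum>p\<in>map_prod f f ` parcs G. y (fst p) * y (snd p))"
    unfolding H.qf_def split_def unfolding f(3) ..
  also have "\<dots> = (\<Sum>p\<in>parcs G. y (f (fst p)) * y (f (snd p)))"
    by (subst sum.reindex[OF inj2]) simp
  also have "\<dots> = (\<Sum>p\<in>parcs G. x (fst p) * x (snd p))"
  proof (rule sum.cong[OF refl])
    fix p assume "p \<in> parcs G"
    then have "fst p \<in> pverts G" "snd p \<in> pverts G"
      using G.E_sub by auto
    then show "y (f (fst p)) * y (f (snd p)) = x (fst p) * x (snd p)"
      by (simp add: y)
  qed
  also have "\<dots> = G.qf x"
    unfolding G.qf_def split_def ..
  finally have "H.qf y = G.qf x" .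
  moreover have "H.sq y = G.sq x"
    unfolding H.sq_def G.sq_def unfolding f(2) by (subst sum.reindex[OF f(1)]) (simp add: y)
  moreover have "G.qf x = graph_spectral_radius G * G.sq x"
    unfolding G.qf_eq G.sq_def sum_distrib_left
    by (intro sum.cong refl) (simp add: x(2) sum_distrib_left[symmetric] power2_eq_square)
  ultimately show ?thesis
    using ray[of y] x(1) by simp
qed

lemma graph_iso_spectral_radius:
  assumes "pair_graph G" "pair_graph H" "pverts G \<noteq> {}" "graph_iso G H"
  shows "graph_spectral_radius G = graph_spectral_radius H"
proof -
  have "pverts H \<noteq> {}"
    using assms(3,4) by (auto elim!: graph_isoE)
  then show ?thesis
    using graph_iso_spectral_radius_le[OF assms]
      graph_iso_spectral_radius_le[OF assms(2,1) _ graph_iso_sym[OF assms(1,4)]] by simp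
qed

lemma contains_copyI:
  assumes G: "pair_graph G" and F: "pair_graph F" and f: "inj_on f (pverts F)"
    and V: "f ` pverts F \<subseteq> pverts G" and E: "map_prod f f ` parcs F \<subseteq> parcs G"
  shows "contains_copy G F"
proof -
  interpret G: pair_graph G
    by (rule G)
  interpret F: sgraph "pverts F" "parcs F"
    by (rule pair_graph_sgraph[OF F])
  define H where "H = \<lparr>pverts = f ` pverts F, parcs = map_prod f f ` parcs F\<rparr>"
  have "sgraph (f ` pverts F) (map_prod f f ` parcs F)"
  proof
    show "map_prod f f ` parcs F \<subseteq> f ` pverts F \<times> f ` pverts F"
      using F.E_V by auto
    show "(v, u) \<in> map_prod f f ` parcs F" if "(u, v) \<in> map_prod f f ` parcs F" for u v
    proof -
      obtain i j where "(i, j) \<in> parcs F" "u = f i" "v = f j"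
        using \<open>(u, v) \<in> map_prod f f ` parcs F\<close> by auto
      then show ?thesis
        using F.E_sym[of i j] by (intro image_eqI[of _ _ "(j, i)"]) simp_all
    qed
    show "(u, u) \<notin> map_prod f f ` parcs F" for u
    proof
      assume "(u, u) \<in> map_prod f f ` parcs F"
      then obtain i j where ij: "(i, j) \<in> parcs F" "f i = f j"
        by auto
      then have "i = j"
        using inj_onD[OF f ij(2)] F.E_V by blast
      with ij(1) show False
        by simp
    qed
  qed simp
  then have H: "pair_graph H"
    unfolding H_def by (rule sgraph_pair_graph)
  then interpret H: pair_graph H .
  have "subgraph (with_proj H) (with_proj G)"
    unfolding subgraph_def compatible_def
    using V E H.wf_digraph_axioms G.wf_digraph_axioms by (simp add: H_def)
  moreover have "graph_iso F H"
    by (rule graph_isoI[OF F f]) (simp_all add: H_def)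
  then have "graph_iso H F"
    by (rule graph_iso_sym[OF F])
  ultimately show ?thesis
    unfolding contains_copy_def using H by blast
qed

lemma contains_copyE:
  assumes "contains_copy G F"
  obtains f where "inj_on f (pverts F)" "f ` pverts F \<subseteq> pverts G" "map_prod f f ` parcs F \<subseteq> parcs G"
proof -
  obtain H where H: "pair_graph H" "subgraph (with_proj H) (with_proj G)" "graph_iso H F"
    using assms unfolding contains_copy_def by blast
  have "graph_iso F H"
    by (rule graph_iso_sym[OF H(1,3)])
  then obtain f where "inj_on f (pverts F)" "pverts H = f ` pverts F" "parcs H = map_prod f f ` parcs F"
    by (rule graph_isoE)
  then show thesis
    using that[of f] H(2) unfolding subgraph_def by simp
qed

text \<open>Take a longest path inside \<open>S\<close>. All neighbours in \<open>S\<close> of its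
  first vertex lie on it, and at least two exist, so one of them sits far enough along the path to
  close a cycle.\<close>

lemma (in sgraph) core_cycle:
  assumes "core S"
  obtains cs where "distinct cs" "set cs \<subseteq> S" "3 \<le> length cs"
    "\<And>i. i < length cs \<Longrightarrow> (cs ! i, cs ! (Suc i mod length cs)) \<in> E"
proof -
  have "S \<subseteq> V" and "S \<noteq> {}"
    using assms unfolding core_def by simp_all
  have finS: "finite S"
    using \<open>S \<subseteq> V\<close> fin_V by (rule finite_subset)
  from \<open>S \<noteq> {}\<close> obtain v0 where v0: "v0 \<in> S"
    by auto
  define P where "P ps \<longleftrightarrow> ps \<noteq> [] \<and> distinct ps \<and> set ps \<subseteq> S \<and>
    (\<forall>i. Suc i < length ps \<longrightarrow> (ps ! i, ps ! Suc i) \<in> E)" for ps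
  have "P [v0]"
    using v0 unfolding P_def by simp
  moreover have "length ps < Suc (card S)" if "P ps" for ps
    using that finS unfolding P_def by (metis card_mono distinct_card less_Suc_eq_le)
  ultimately obtain ps where ps: "P ps" "\<And>qs. P qs \<Longrightarrow> length qs \<le> length ps"
    using ex_has_greatest_nat[of P "[v0]" length "Suc (card S)"] by (metis (no_types))
  then obtain v rest where vr: "ps = v # rest"
    unfolding P_def by (cases ps) auto
  have vS: "v \<in> S"
    using ps(1) vr unfolding P_def by simp
  have nbr: "t \<in> set ps" if "t \<in> S" "(v, t) \<in> E" for t
  proof (rule ccontr)
    assume t: "t \<notin> set ps"
    have "P (t # ps)"
      unfolding P_def
    proof (intro conjI allI impI)
      fix i assume "Suc i < length (t # ps)"
      then show "((t # ps) ! i, (t # ps) ! Suc i) \<in> E"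
        using ps(1) that(2) E_sym vr unfolding P_def by (cases i) auto
    qed (use t ps(1) that in \<open>auto simp: P_def\<close>)
    from ps(2)[OF this] show False
      by simp
  qed
  obtain p q where pq: "p \<in> S" "q \<in> S" "p \<noteq> q" "(v, p) \<in> E" "(v, q) \<in> E"
    by (rule coreE[OF assms vS])
  obtain i where i: "i < length ps" "ps ! i = p"
    using nbr[OF pq(1,4)] by (meson in_set_conv_nth)
  obtain j where j: "j < length ps" "ps ! j = q"
    using nbr[OF pq(2,5)] by (meson in_set_conv_nth)
  have "i \<noteq> 0" "j \<noteq> 0"
    using i j pq vr by (metis E_irrefl nth_Cons_0)+
  moreover have "i \<noteq> j"
    using i j pq by auto
  \<comment> \<open>The two neighbours occupy different positions, neither of them 0, so one has
    position at least 2. This is why the cycle has length at least 3.\<close>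
  ultimately obtain k where k: "2 \<le> k" "k < length ps" "(v, ps ! k) \<in> E"
    using i j pq(4,5) by (cases "i < j") (metis Suc_leI Suc_1 le_neq_implies_less less_one linorder_not_le neq0_conv)+
  define cs where "cs = take (Suc k) ps"
  have len: "length cs = Suc k"
    using k unfolding cs_def by simp
  have nth: "cs ! i = ps ! i" if "i \<le> k" for i
    using that unfolding cs_def by simp
  show thesis
  proof (rule that[of cs])
    show "distinct cs" "set cs \<subseteq> S"
      using ps(1) set_take_subset[of "Suc k" ps] unfolding cs_def P_def by auto
    show "3 \<le> length cs"
      using len k by simp
    fix i assume i: "i < length cs"
    show "(cs ! i, cs ! (Suc i mod length cs)) \<in> E"
    proof (cases "i = k")
      case True
      then show ?thesis
        using nth[of k] nth[of 0] len k(3) vr E_sym by simp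
    next
      case False
      then show ?thesis
        using i len nth[of i] nth[of "Suc i"] ps(1) k unfolding P_def by simp
    qed
  qed
qed

lemma sgraph_cycle: "3 \<le> k \<Longrightarrow> sgraph (pverts (cycle_graph k)) (parcs (cycle_graph k))"
  by unfold_locales (auto simp: cycle_graph_def mod_Suc split: if_splits)

lemma in_map_prod_Inl [simp]: "(Inl i, Inl j) \<in> map_prod Inl Inl ` A \<longleftrightarrow> (i, j) \<in> A"
  and in_map_prod_Inr [simp]: "(Inr i, Inr j) \<in> map_prod Inr Inr ` A \<longleftrightarrow> (i, j) \<in> A"
  by (auto intro: rev_image_eqI)

lemma sgraph_disjoint_union:
  assumes "sgraph (pverts G) (parcs G)" "sgraph (pverts H) (parcs H)"
  shows "sgraph (pverts (disjoint_union G H)) (parcs (disjoint_union G H))"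
proof -
  interpret G: sgraph "pverts G" "parcs G"
    by fact
  interpret H: sgraph "pverts H" "parcs H"
    by fact
  show ?thesis
    by unfold_locales
      (use G.E_V H.E_V G.E_sym H.E_sym in \<open>auto simp: disjoint_union_def\<close>)
qed

text \<open>Every core contains the vertices of a cycle, and the vertices of a cycle form a core;
  disjointness is preserved in both directions.\<close>

lemma two_cycles_free_iff:
  assumes G: "pair_graph G"
  shows "family_free two_cycles G \<longleftrightarrow>
    (\<forall>S S'. sgraph.core (pverts G) (parcs G) S \<and> sgraph.core (pverts G) (parcs G) S' \<longrightarrow> S \<inter> S' \<noteq> {})"
proof -
  interpret sgraph "pverts G" "parcs G"
    by (rule pair_graph_sgraph[OF G])
  have "\<exists>F\<in>two_cycles. contains_copy G F" if S: "core S" "core S'" "S \<inter> S' = {}" for S S'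
  proof -
    obtain cs where cs: "distinct cs" "set cs \<subseteq> S" "3 \<le> length cs"
      "\<And>i. i < length cs \<Longrightarrow> (cs ! i, cs ! (Suc i mod length cs)) \<in> parcs G"
      by (rule core_cycle[OF S(1)]) (rule that; assumption)
    obtain ds where ds: "distinct ds" "set ds \<subseteq> S'" "3 \<le> length ds"
      "\<And>i. i < length ds \<Longrightarrow> (ds ! i, ds ! (Suc i mod length ds)) \<in> parcs G"
      by (rule core_cycle[OF S(2)]) (rule that; assumption)
    let ?F = "disjoint_union (cycle_graph (length cs)) (cycle_graph (length ds))"
    define f where "f = case_sum ((!) cs) ((!) ds)"
    have V: "pverts ?F = {..<length cs} <+> {..<length ds}"
      by (simp add: disjoint_union_def cycle_graph_def)
    have nth: "i < length cs \<Longrightarrow> cs ! i \<in> S" "j < length ds \<Longrightarrow> ds ! j \<in> S'" for i j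
      using cs(2) ds(2) by (auto dest: nth_mem)
    then have ne: "cs ! i \<noteq> ds ! j" if "i < length cs" "j < length ds" for i j
      using that S(3) by (metis disjoint_iff)
    have "contains_copy G ?F"
    proof (rule contains_copyI[OF G])
      show "pair_graph ?F"
        unfolding pair_graph_iff_sgraph by (intro sgraph_disjoint_union sgraph_cycle cs ds)
      show "inj_on f (pverts ?F)"
        unfolding V f_def by (rule inj_onI)
          (use cs(1) ds(1) ne ne[symmetric] in \<open>auto simp: nth_eq_iff_index_eq\<close>)
      have "S \<subseteq> pverts G" "S' \<subseteq> pverts G"
        using S unfolding core_def by auto
      then show "f ` pverts ?F \<subseteq> pverts G"
        unfolding V f_def using nth by auto
      show "map_prod f f ` parcs ?F \<subseteq> parcs G"
        unfolding disjoint_union_def cycle_graph_def f_def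
        using cs(4) ds(4) E_sym by auto
    qed
    then show ?thesis
      using cs(3) ds(3) unfolding two_cycles_def by blast
  qed
  moreover have "\<exists>S S'. core S \<and> core S' \<and> S \<inter> S' = {}" if F: "F \<in> two_cycles" "contains_copy G F" for F
  proof -
    obtain k l where kl: "3 \<le> k" "3 \<le> l" "F = disjoint_union (cycle_graph k) (cycle_graph l)"
      using F(1) unfolding two_cycles_def by auto
    obtain f where f: "inj_on f (pverts F)" "f ` pverts F \<subseteq> pverts G" "map_prod f f ` parcs F \<subseteq> parcs G"
      using F(2) by (rule contains_copyE)
    have V: "pverts F = {..<k} <+> {..<l}"
      by (simp add: kl disjoint_union_def cycle_graph_def)
    have arcs: "(f (Inl i), f (Inl j)) \<in> parcs G" if "(i, j) \<in> parcs (cycle_graph k)" for i j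
      using f(3) that unfolding kl(3) disjoint_union_def by (force simp: image_subset_iff)
    have arcs': "(f (Inr i), f (Inr j)) \<in> parcs G" if "(i, j) \<in> parcs (cycle_graph l)" for i j
      using f(3) that unfolding kl(3) disjoint_union_def by (force simp: image_subset_iff)
    have core_cyc: "core (g ` {..<m})" if m: "3 \<le> m" and g: "inj_on g {..<m}" "g ` {..<m} \<subseteq> pverts G"
      "\<And>i j. (i, j) \<in> parcs (cycle_graph m) \<Longrightarrow> (g i, g j) \<in> parcs G" for g :: "nat \<Rightarrow> 'a" and m
    proof (rule coreI)
      show "g ` {..<m} \<noteq> {}"
        using m by (simp add: lessThan_empty_iff)
      show "g ` {..<m} \<subseteq> pverts G"
        by (rule g)
      fix v assume "v \<in> g ` {..<m}"
      then obtain i where i: "i < m" "v = g i"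
        by auto
      \<comment> \<open>Successor and predecessor of \<open>i\<close> on the cycle, the predecessor
        of 0 being \<open>m - 1\<close>. They differ because \<open>m >= 3\<close>.\<close>
      define p q where "p = Suc i mod m" and "q = (if i = 0 then m - 1 else i - 1)"
      have pq: "p < m" "q < m" "p \<noteq> q" "i = Suc q mod m"
        using m i unfolding p_def q_def by (auto simp: mod_Suc)
      then have "g p \<noteq> g q"
        using g(1) by (auto dest: inj_onD)
      moreover have "(g i, g p) \<in> parcs G" "(g i, g q) \<in> parcs G"
        by (rule g(3); use pq i in \<open>auto simp: cycle_graph_def p_def\<close>)+
      ultimately show "\<exists>p\<in>g ` {..<m}. \<exists>q\<in>g ` {..<m}. p \<noteq> q \<and> (v, p) \<in> parcs G \<and> (v, q) \<in> parcs G"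
        using pq i by blast
    qed
    have "core ((f \<circ> Inl) ` {..<k})"
      by (rule core_cyc) (use kl f V arcs in \<open>auto simp: inj_on_def image_subset_iff\<close>)
    moreover have "core ((f \<circ> Inr) ` {..<l})"
      by (rule core_cyc) (use kl f V arcs' in \<open>auto simp: inj_on_def image_subset_iff\<close>)
    moreover have "(f \<circ> Inl) ` {..<k} \<inter> (f \<circ> Inr) ` {..<l} = {}"
      using f(1) V by (auto simp: inj_on_def)
    ultimately show ?thesis
      by blast
  qed
  ultimately show ?thesis
    unfolding family_free_def by blast
qed

section \<open>The extremal graph\<close>

text \<open>A path contains no core, so every core contains a hub, and disjoint cores have just one
  each. A non-hub vertex of such a core then needs a neighbour along the path
  \<open>a, b, c\<close>, which brings in \<open>b\<close>. Both cores would contain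
  \<open>b\<close>.\<close>

lemma k2p3_no_disjoint_cores:
  assumes fin: "finite V" and dist: "distinct [u, v, a, b, c]"
    and S: "sgraph.core V (k2p3_arcs V u v a b c) S" "sgraph.core V (k2p3_arcs V u v a b c) S'"
  shows "S \<inter> S' \<noteq> {}"
proof
  assume disj: "S \<inter> S' = {}"
  define E where "E = k2p3_arcs V u v a b c"
  interpret sgraph V E
    unfolding E_def by (rule sgraph_k2p3[OF fin])
  have E: "(p, q) \<in> E \<Longrightarrow> p \<in> {u, v} \<or> q \<in> {u, v} \<or> {p, q} = {a, b} \<or> {p, q} = {b, c}" for p q
    unfolding E_def k2p3_arcs_def by blast
  have path: "b \<in> T \<and> (\<exists>q\<in>T. q \<in> {a, c})" if T: "core T" "\<not> {u, v} \<subseteq> T" for T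
  proof -
    obtain s where s: "s \<in> T"
      using T(1) unfolding core_def by blast
    have "\<exists>p\<in>T. p \<notin> {u, v}"
    proof (cases "s \<in> {u, v}")
      case True
      obtain p q where "p \<in> T" "q \<in> T" "p \<noteq> q" "(s, p) \<in> E" "(s, q) \<in> E"
        by (rule coreE[OF T(1) s])
      then have "p \<noteq> s" by auto
      then show ?thesis
        using True T(2) s \<open>p \<in> T\<close> by (intro bexI[of _ p]) auto
    qed (use s in blast)
    then obtain p where p: "p \<in> T" "p \<notin> {u, v}"
      by blast
    obtain q q' where q: "q \<in> T" "q' \<in> T" "q \<noteq> q'" "(p, q) \<in> E" "(p, q') \<in> E"
      by (rule coreE[OF T(1) p(1)])
    have "q \<notin> {u, v} \<or> q' \<notin> {u, v}"
      using T(2) q(1-3) by blast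
    then have "{p, q} = {a, b} \<or> {p, q} = {b, c} \<or> {p, q'} = {a, b} \<or> {p, q'} = {b, c}"
      using E[OF q(4)] E[OF q(5)] p(2) by satx
    then show ?thesis
      using p(1) q(1,2) by (auto simp: doubleton_eq_iff)
  qed
  have hub: "u \<in> T \<or> v \<in> T" if T: "core T" for T
  proof (rule ccontr)
    assume no: "\<not> ?thesis"
    then obtain p where p: "p \<in> T" "p \<in> {a, c}"
      using path[OF T] by auto
    obtain q q' where q: "q \<in> T" "q' \<in> T" "q \<noteq> q'" "(p, q) \<in> E" "(p, q') \<in> E"
      by (rule coreE[OF T p(1)])
    have only_b: "t = b" if "t \<in> T" "(p, t) \<in> E" for t
      using E[OF that(2)] that(1) p no dist by (auto simp: doubleton_eq_iff)
    show False
      using only_b[OF q(1,4)] only_b[OF q(2,5)] q(3) by simp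
  qed
  have cores: "core S" "core S'"
    using S unfolding E_def by simp_all
  have "\<not> {u, v} \<subseteq> S" "\<not> {u, v} \<subseteq> S'"
    using hub[OF cores(1)] hub[OF cores(2)] disj by auto
  then have "b \<in> S" "b \<in> S'"
    using path[OF cores(1)] path[OF cores(2)] by simp_all
  then show False
    using disj by auto
qed

text \<open>All vertices other than the five named ones have exactly the neighbours \<open>u\<close>
  and \<open>v\<close>, so any bijection that matches the named vertices is an isomorphism.\<close>

lemma k2p3_iso:
  assumes V: "finite V" "distinct [u, v, a, b, c]" "{u, v, a, b, c} \<subseteq> V"
    and W: "finite W" "distinct [u', v', a', b', c']" "{u', v', a', b', c'} \<subseteq> W"
    and card: "card V = card W"
  shows "graph_iso \<lparr>pverts = V, parcs = k2p3_arcs V u v a b c\<rparr>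
    \<lparr>pverts = W, parcs = k2p3_arcs W u' v' a' b' c'\<rparr>"
proof -
  let ?X = "{u, v, a, b, c}" and ?Y = "{u', v', a', b', c'}"
  have "card ?X = 5" "card ?Y = 5"
    using V(2) W(2) by auto
  then have "card (V - ?X) = card (W - ?Y)"
    using V(3) W(3) card by (simp add: card_Diff_subset)
  then obtain g where g: "bij_betw g (V - ?X) (W - ?Y)"
    using finite_same_card_bij V(1) W(1) by (metis finite_Diff)
  define f where "f p = (if p = u then u' else if p = v then v' else if p = a then a' else
    if p = b then b' else if p = c then c' else g p)" for p
  have fX: "f u = u'" "f v = v'" "f a = a'" "f b = b'" "f c = c'"
    unfolding f_def using V(2) by auto
  have fg: "f p = g p" if "p \<notin> ?X" for p
    unfolding f_def using that by auto
  have "bij_betw f ?X ?Y"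
    unfolding bij_betw_def inj_on_def using fX V(2) W(2) by auto
  moreover have "bij_betw f (V - ?X) (W - ?Y)"
    using g by (rule bij_betw_cong[THEN iffD1, rotated]) (use fg in auto)
  ultimately have "bij_betw f (?X \<union> (V - ?X)) (?Y \<union> (W - ?Y))"
    by (rule bij_betw_combine) auto
  moreover have "?X \<union> (V - ?X) = V" "?Y \<union> (W - ?Y) = W"
    using V(3) W(3) by auto
  ultimately have bij: "bij_betw f V W"
    by (simp only:)
  then have inj: "inj_on f V" and im: "f ` V = W"
    by (auto simp: bij_betw_def)
  have eq: "f p = f q \<longleftrightarrow> p = q" if "p \<in> V" "q \<in> V" for p q
    using inj_on_eq_iff[OF inj that] .
  have arc: "(f p, f q) \<in> k2p3_arcs W u' v' a' b' c' \<longleftrightarrow> (p, q) \<in> k2p3_arcs V u v a b c"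
    if pq: "p \<in> V" "q \<in> V" for p q
  proof -
    have "f p = f t \<longleftrightarrow> p = t" "f q = f t \<longleftrightarrow> q = t" if "t \<in> ?X" for t
      using eq[OF pq(1)] eq[OF pq(2)] that V(3) by blast+
    then have "f p = u' \<longleftrightarrow> p = u" "f p = v' \<longleftrightarrow> p = v" "f p = a' \<longleftrightarrow> p = a" "f p = b' \<longleftrightarrow> p = b"
      "f p = c' \<longleftrightarrow> p = c" "f q = u' \<longleftrightarrow> q = u" "f q = v' \<longleftrightarrow> q = v" "f q = a' \<longleftrightarrow> q = a"
      "f q = b' \<longleftrightarrow> q = b" "f q = c' \<longleftrightarrow> q = c"
      unfolding fX[symmetric] by simp_all
    moreover have "f p \<in> W" "f q \<in> W"
      using pq im by auto
    ultimately show ?thesis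
      using pq eq[OF pq] by (simp add: k2p3_arcs_def doubleton_eq_iff)
  qed
  show ?thesis
  proof (rule graph_isoI)
    show "pair_graph \<lparr>pverts = V, parcs = k2p3_arcs V u v a b c\<rparr>"
      by (rule sgraph_pair_graph[OF sgraph_k2p3[OF V(1)]])
    have "k2p3_arcs W u' v' a' b' c' = map_prod f f ` k2p3_arcs V u v a b c"
    proof (intro equalityI subsetI)
      fix e assume e: "e \<in> k2p3_arcs W u' v' a' b' c'"
      then have "fst e \<in> f ` V" "snd e \<in> f ` V"
        unfolding im k2p3_arcs_def by auto
      then obtain p q where pq: "p \<in> V" "q \<in> V" "e = (f p, f q)"
        by (metis imageE prod.collapse)
      then show "e \<in> map_prod f f ` k2p3_arcs V u v a b c"
        using e arc[OF pq(1,2)] by (intro image_eqI[of _ _ "(p, q)"]) simp_all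
    next
      fix e assume "e \<in> map_prod f f ` k2p3_arcs V u v a b c"
      then obtain p q where pq: "(p, q) \<in> k2p3_arcs V u v a b c" "e = (f p, f q)"
        by auto
      moreover have "p \<in> V" "q \<in> V"
        using pq(1) unfolding k2p3_arcs_def by auto
      ultimately show "e \<in> k2p3_arcs W u' v' a' b' c'"
        using arc by simp
    qed
    then show "parcs \<lparr>pverts = W, parcs = k2p3_arcs W u' v' a' b' c'\<rparr> =
        map_prod f f ` parcs \<lparr>pverts = V, parcs = k2p3_arcs V u v a b c\<rparr>"
      by simp
  qed (use inj im in simp_all)
qed

text \<open>The test vector is the leading eigenvector of K_{2,m} with m = n - 2. The value
  \<open>t = sqrt (m / 2)\<close> gives the two sides equal norm, and the quotient becomes 4 m t /
  (2 m) = sqrt (2 m).\<close>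

lemma k2p3_spectral_radius_ge:
  assumes fin: "finite V" and dist: "distinct [u, v, a, b, c]" "{u, v, a, b, c} \<subseteq> V"
  shows "graph_spectral_radius \<lparr>pverts = V, parcs = k2p3_arcs V u v a b c\<rparr>
    \<ge> sqrt (2 * real (card V) - 4)"
proof -
  define E where "E = k2p3_arcs V u v a b c"
  interpret sgraph V E
    unfolding E_def by (rule sgraph_k2p3[OF fin])
  let ?G = "\<lparr>pverts = V, parcs = E\<rparr>"
  define m where "m = real (card V) - 2"
  define t where "t = sqrt (m / 2)"
  let ?O = "V - {u, v}"
  have uv: "u \<noteq> v" "u \<in> V" "v \<in> V"
    using dist by auto
  have "card {u, v, a, b, c} \<le> card V"
    using fin dist(2) by (rule card_mono)
  then have cV: "card V \<ge> 5"
    using dist(1) by simp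
  then have m: "m > 0"
    unfolding m_def by simp
  then have t: "t > 0" "t\<^sup>2 = m / 2"
    unfolding t_def by auto
  have cO: "real (card ?O) = m"
    using uv cV fin by (simp add: m_def card_Diff_subset of_nat_diff)
  define y where "y p = (if p \<in> {u, v} then t else 1)" for p
  have sub: "{u, v} \<subseteq> V"
    using uv by simp
  have "sq y = (\<Sum>p\<in>?O. (y p)\<^sup>2) + (\<Sum>p\<in>{u, v}. (y p)\<^sup>2)"
    unfolding sq_def using sum.subset_diff[OF sub fin] .
  also have "(\<Sum>p\<in>?O. (y p)\<^sup>2) = (\<Sum>p\<in>?O. 1)"
    by (rule sum.cong) (auto simp: y_def)
  also have "\<dots> = m"
    using cO by simp
  also have "(\<Sum>p\<in>{u, v}. (y p)\<^sup>2) = m"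
    using uv t by (simp add: y_def)
  finally have sqy: "sq y = 2 * m"
    by simp
  have "(\<Sum>p\<in>{u, v} \<times> ?O \<union> ?O \<times> {u, v}. y (fst p) * y (snd p)) \<le> (\<Sum>p\<in>E. y (fst p) * y (snd p))"
  proof (rule sum_mono2)
    show "{u, v} \<times> ?O \<union> ?O \<times> {u, v} \<subseteq> E"
      unfolding E_def k2p3_arcs_def using uv by auto
  qed (use t in \<open>auto simp: y_def\<close>)
  also have "(\<Sum>p\<in>{u, v} \<times> ?O \<union> ?O \<times> {u, v}. y (fst p) * y (snd p))
      = (\<Sum>p\<in>{u, v} \<times> ?O \<union> ?O \<times> {u, v}. t)"
    by (rule sum.cong) (auto simp: y_def)
  also have "\<dots> = real (card ({u, v} \<times> ?O \<union> ?O \<times> {u, v})) * t"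
    by simp
  also have "card ({u, v} \<times> ?O \<union> ?O \<times> {u, v}) = card ({u, v} \<times> ?O) + card (?O \<times> {u, v})"
    using fin by (intro card_Un_disjoint) auto
  also have "real (card ({u, v} \<times> ?O) + card (?O \<times> {u, v})) = 4 * m"
    using uv cO by (simp only: card_cartesian_product of_nat_add of_nat_mult) simp
  finally have qfy: "4 * m * t \<le> qf y"
    unfolding qf_def by (simp add: split_def)
  have G: "pair_graph ?G" "pverts ?G \<noteq> {}"
    using sgraph_pair_graph[OF sgraph_axioms] uv by auto
  have "sgraph.qf (parcs ?G) y \<le> graph_spectral_radius ?G * sgraph.sq (pverts ?G) y"
    by (rule spectral_radius_rayleigh[OF G])
  then have "qf y \<le> graph_spectral_radius ?G * sq y"
    by simp
  then have "4 * m * t \<le> graph_spectral_radius ?G * (2 * m)"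
    using qfy unfolding sqy by (rule order_trans[rotated])
  then have "2 * t \<le> graph_spectral_radius ?G"
    using m by (simp add: field_simps)
  moreover have "sqrt (2 * real (card V) - 4) = 2 * t"
  proof (rule real_sqrt_unique)
    show "(2 * t)\<^sup>2 = 2 * real (card V) - 4"
      using t by (simp add: power_mult_distrib m_def)
  qed (use t in simp)
  ultimately show ?thesis
    unfolding E_def by simp
qed

section \<open>A straight-line drawing of the extremal graph\<close>

lemma segment_imaginary_hub:
  assumes "z \<in> closed_segment (Complex 0 s) (of_nat k)"
  shows "\<exists>t. 0 \<le> t \<and> t \<le> 1 \<and> Re z = t * real k \<and> Im z = (1 - t) * s"
  using assms by (auto simp: closed_segment_def)

lemma segment_imaginary:
  assumes "z \<in> closed_segment (Complex 0 1) (Complex 0 (-1))"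
  shows "Re z = 0"
  using assms by (auto simp: closed_segment_def)

lemma segment_real:
  assumes "z \<in> closed_segment (of_nat k) (of_nat (Suc k))"
  shows "Im z = 0 \<and> real k \<le> Re z \<and> Re z \<le> real k + 1"
  using assms by (auto simp: closed_segment_def algebra_simps)

text \<open>
  The two hubs are drawn at \<open>\<i>\<close> and \<open>-\<i>\<close>, all other vertices at positive integers, with
  the path \<open>a, b, c\<close> at 1, 2, 3; every edge is a straight segment.
\<close>

lemma planar_k2p3:
  assumes fin: "finite V" and dist: "distinct [u, v, a, b, c]" "{u, v, a, b, c} \<subseteq> V"
  shows "planar \<lparr>pverts = V, parcs = k2p3_arcs V u v a b c\<rparr>" (is "planar ?G")
proof -
  let ?O = "V - {u, v}"
  obtain g0 :: "'a \<Rightarrow> nat" where g0: "inj_on g0 V"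
    using finite_imp_inj_to_nat_seg[OF fin] by blast
  \<comment> \<open>The offset 4 keeps the remaining vertices away from 1, 2, 3, so that no vertex
    lies inside the segments for \<open>a, b\<close> and \<open>b, c\<close>.\<close>
  define g where "g q = (if q = a then 1 else if q = b then 2 else if q = c then 3 else g0 q + 4)" for q
  have g_abc: "g a = 1" "g b = 2" "g c = 3"
    using dist(1) unfolding g_def by auto
  have g_pos: "g q > 0" for q
    unfolding g_def by simp
  have g_inj: "g q = g q' \<longleftrightarrow> q = q'" if "q \<in> V" "q' \<in> V" for q q'
    using inj_on_eq_iff[OF g0 that] dist(1) unfolding g_def by auto
  define p where "p q = (if q = u then Complex 0 1 else if q = v then Complex 0 (-1) else of_nat (g q))" for q
  have p_uv: "p u = Complex 0 1" "p v = Complex 0 (-1)"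
    using dist(1) unfolding p_def by auto
  have p_O: "p q = of_nat (g q)" if "q \<in> ?O" for q
    using that unfolding p_def by auto
  have abc: "a \<in> ?O" "b \<in> ?O" "c \<in> ?O" and uv: "u \<in> V" "v \<in> V" "u \<noteq> v"
    using dist by auto
  have V_cases: "q = u \<or> q = v \<or> q \<in> ?O" if "q \<in> V" for q
    using that by auto
  have Re_pos: "Re (p q) \<ge> 1" "Im (p q) = 0" "Re (p q) = real (g q)" if "q \<in> ?O" for q
    using p_O[OF that] g_pos[of q] by auto
  have p_neq_uv: "p q \<noteq> p u" "p q \<noteq> p v" if "q \<in> ?O" for q
    using Re_pos(1)[OF that] p_uv by auto
  have inj: "inj_on p V"
  proof (rule inj_onI)
    fix q q' assume q: "q \<in> V" "q' \<in> V" "p q = p q'"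
    show "q = q'"
    proof (cases "q \<in> ?O \<and> q' \<in> ?O")
      case True
      then show ?thesis
        using q g_inj[of q q'] by (simp add: p_O)
    next
      case False
      then show ?thesis
        using V_cases[OF q(1)] V_cases[OF q(2)] q(3) p_neq_uv p_uv by (metis complex.inject one_neq_neg_one)
    qed
  qed
  \<comment> \<open>Edges are unordered, so an orientation has to be chosen for each; the image of
    the segment does not depend on it.\<close>
  define s where "s e = (SOME st. e = {fst st, snd st})" for e :: "'a set"
  define \<gamma> where "\<gamma> e = linepath (p (fst (s e))) (p (snd (s e)))" for e
  have s: "{fst (s e), snd (s e)} = e" if "e = {i, j}" for e i j
  proof -
    have "e = {fst (i, j), snd (i, j)}"
      using that by simp
    then have "e = {fst (s e), snd (s e)}"
      unfolding s_def by (rule someI)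
    then show ?thesis ..
  qed
  have img: "path_image (\<gamma> {i, j}) = closed_segment (p i) (p j)" for i j
  proof -
    from s[of "{i, j}" i j] have "fst (s {i, j}) = i \<and> snd (s {i, j}) = j \<or> fst (s {i, j}) = j \<and> snd (s {i, j}) = i"
      by (auto simp: doubleton_eq_iff)
    then show ?thesis
      unfolding \<gamma>_def by (auto simp: closed_segment_commute)
  qed
  have edge_ij: "\<exists>i j. i \<in> V \<and> j \<in> V \<and> i \<noteq> j \<and> e = {i, j}" if "e \<in> edges ?G" for e
    using that unfolding edges_def k2p3_arcs_def by auto
  have edge_cases: "e = {u, v} \<or> (\<exists>q\<in>?O. e = {u, q}) \<or> (\<exists>q\<in>?O. e = {v, q}) \<or> e = {a, b} \<or> e = {b, c}"
    if "e \<in> edges ?G" for e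
    using that uv unfolding edges_def k2p3_arcs_def by (auto simp: insert_commute)
  have seg_uv: "Re z = 0" if "z \<in> path_image (\<gamma> {u, v})" for z
    using segment_imaginary that unfolding img p_uv by blast
  have seg_u: "\<exists>t. 0 \<le> t \<and> t \<le> 1 \<and> Re z = t * real (g q) \<and> Im z = 1 - t"
    if "z \<in> path_image (\<gamma> {u, q})" "q \<in> ?O" for z q
    using segment_imaginary_hub[of z 1 "g q"] that unfolding img p_uv p_O[OF that(2)] by simp
  have seg_v: "\<exists>t. 0 \<le> t \<and> t \<le> 1 \<and> Re z = t * real (g q) \<and> Im z = t - 1"
    if "z \<in> path_image (\<gamma> {v, q})" "q \<in> ?O" for z q
    using segment_imaginary_hub[of z "-1" "g q"] that unfolding img p_uv p_O[OF that(2)] by simp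
  have seg_ab: "Im z = 0 \<and> 1 \<le> Re z \<and> Re z \<le> 2" if "z \<in> path_image (\<gamma> {a, b})" for z
    using segment_real[of z 1] that unfolding img p_O[OF abc(1)] p_O[OF abc(2)] g_abc
    by (simp add: numeral_2_eq_2)
  have seg_bc: "Im z = 0 \<and> 2 \<le> Re z \<and> Re z \<le> 3" if "z \<in> path_image (\<gamma> {b, c})" for z
    using segment_real[of z 2] that unfolding img p_O[OF abc(2)] p_O[OF abc(3)] g_abc
    by (simp add: numeral_3_eq_3)
  have real_point: "z = p q" if "Im z = 0" "Re z = real (g q)" "q \<in> ?O" for z q
    using that p_O[OF that(3)] by (simp add: complex_eq_iff)
  have g_1: "q = a \<or> q = b" if "q \<in> ?O" "1 \<le> real (g q)" "real (g q) \<le> 2" for q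
  proof -
    have "g q = 1 \<or> g q = 2"
      using that by linarith
    then show ?thesis
      using that(1) g_inj[of q a] g_inj[of q b] g_abc abc by auto
  qed
  have g_2: "q = b \<or> q = c" if "q \<in> ?O" "2 \<le> real (g q)" "real (g q) \<le> 3" for q
  proof -
    have "g q = 2 \<or> g q = 3"
      using that by linarith
    then show ?thesis
      using that(1) g_inj[of q c] g_inj[of q b] g_abc abc by auto
  qed
  \<comment> \<open>Edges from \<open>u\<close> to the axis lie in the closed upper half-plane,
    those from \<open>v\<close> in the lower one, and each meets the real axis only at its integer
    end. This settles all crossings between edges at different hubs and with the path.\<close>
  have on_axis_u: "z = p q" if "z \<in> path_image (\<gamma> {u, q})" "q \<in> ?O" "Im z \<le> 0" for z q
    using seg_u[OF that(1,2)] that(2,3) by (auto intro!: real_point)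
  have on_axis_v: "z = p q" if "z \<in> path_image (\<gamma> {v, q})" "q \<in> ?O" "Im z \<ge> 0" for z q
    using seg_v[OF that(1,2)] that(2,3) by (auto intro!: real_point)
  have hub_u: "z = p u" if "z \<in> path_image (\<gamma> {u, q})" "q \<in> ?O" "Re z = 0" for z q
    using seg_u[OF that(1,2)] that(3) g_pos[of q] p_uv by (auto simp: complex_eq_iff)
  have hub_v: "z = p v" if "z \<in> path_image (\<gamma> {v, q})" "q \<in> ?O" "Re z = 0" for z q
    using seg_v[OF that(1,2)] that(3) g_pos[of q] p_uv by (auto simp: complex_eq_iff)
  \<comment> \<open>The height of a common point determines its parameter on both segments; equal
    real parts then force the parameter to be 0.\<close>
  have two_u: "z = p u" if A: "z \<in> path_image (\<gamma> {u, q})" "z \<in> path_image (\<gamma> {u, q'})"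
    "q \<in> ?O" "q' \<in> ?O" "q \<noteq> q'" for z q q'
  proof -
    obtain t where t: "Re z = t * real (g q)" "Im z = 1 - t"
      using seg_u[OF A(1,3)] by blast
    moreover obtain t' where t': "Re z = t' * real (g q')" "Im z = 1 - t'"
      using seg_u[OF A(2,4)] by blast
    ultimately have "t = t'" "t * real (g q) = t * real (g q')"
      by auto
    then have "t = 0"
      using g_inj[of q q'] A(3-5) by auto
    then show ?thesis
      using t p_uv by (simp add: complex_eq_iff)
  qed
  have two_v: "z = p v" if A: "z \<in> path_image (\<gamma> {v, q})" "z \<in> path_image (\<gamma> {v, q'})"
    "q \<in> ?O" "q' \<in> ?O" "q \<noteq> q'" for z q q'
  proof -
    obtain t where t: "Re z = t * real (g q)" "Im z = t - 1"
      using seg_v[OF A(1,3)] by blast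
    moreover obtain t' where t': "Re z = t' * real (g q')" "Im z = t' - 1"
      using seg_v[OF A(2,4)] by blast
    ultimately have "t = t'" "t * real (g q) = t * real (g q')"
      by auto
    then have "t = 0"
      using g_inj[of q q'] A(3-5) by auto
    then show ?thesis
      using t p_uv by (simp add: complex_eq_iff)
  qed
  have Im_u: "Im z \<ge> 0" if "z \<in> path_image (\<gamma> {u, q})" "q \<in> ?O" for z q
    using seg_u[OF that] by auto
  have Im_v: "Im z \<le> 0" if "z \<in> path_image (\<gamma> {v, q})" "q \<in> ?O" for z q
    using seg_v[OF that] by auto
  have u_v: "q = q' \<and> z = p q" if "z \<in> path_image (\<gamma> {u, q})" "z \<in> path_image (\<gamma> {v, q'})"
    "q \<in> ?O" "q' \<in> ?O" for z q q'
  proof -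
    have "z = p q" "z = p q'"
      using on_axis_u[OF that(1,3)] on_axis_v[OF that(2,4)] Im_u[OF that(1,3)] Im_v[OF that(2,4)] by auto
    then show ?thesis
      using inj that(3,4) by (auto dest: inj_onD)
  qed
  have hub_ab: "z = p q \<and> (q = a \<or> q = b)" if "z \<in> path_image (\<gamma> {h, q})" "z \<in> path_image (\<gamma> {a, b})"
    "q \<in> ?O" "h \<in> {u, v}" for z q h
  proof -
    have "z = p q"
      using on_axis_u[of z q] on_axis_v[of z q] seg_ab[OF that(2)] that(1,3,4) by auto
    then show ?thesis
      using g_1[OF that(3)] seg_ab[OF that(2)] Re_pos[OF that(3)] by simp
  qed
  have hub_bc: "z = p q \<and> (q = b \<or> q = c)" if "z \<in> path_image (\<gamma> {h, q})" "z \<in> path_image (\<gamma> {b, c})"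
    "q \<in> ?O" "h \<in> {u, v}" for z q h
  proof -
    have "z = p q"
      using on_axis_u[of z q] on_axis_v[of z q] seg_bc[OF that(2)] that(1,3,4) by auto
    then show ?thesis
      using g_2[OF that(3)] seg_bc[OF that(2)] Re_pos[OF that(3)] by simp
  qed
  have ab_bc: "z = p b" if "z \<in> path_image (\<gamma> {a, b})" "z \<in> path_image (\<gamma> {b, c})" for z
    using seg_ab[OF that(1)] seg_bc[OF that(2)] abc(2) g_abc by (intro real_point) auto
  have vert: "q \<in> e" if e: "e \<in> edges ?G" and q: "q \<in> V" "p q \<in> path_image (\<gamma> e)" for e q
  proof -
    consider "q = u" | "q = v" | "q \<in> ?O"
      using V_cases[OF q(1)] by blast
    then show ?thesis
    proof cases
      case 1
      then show ?thesis
        using edge_cases[OF e] q(2) Im_v seg_ab seg_bc p_uv by fastforce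
    next
      case 2
      then show ?thesis
        using edge_cases[OF e] q(2) Im_u seg_ab seg_bc p_uv by fastforce
    next
      case 3
      note qO = this
      have eqp: "q = q'" if "p q = p q'" "q' \<in> ?O" for q'
        using inj that q(1) by (auto dest: inj_onD)
      from edge_cases[OF e] consider "e = {u, v}" | h q' where "h \<in> {u, v}" "q' \<in> ?O" "e = {h, q'}"
        | "e = {a, b}" | "e = {b, c}"
        by auto
      then show ?thesis
      proof cases
        case 1
        then show ?thesis
          using seg_uv q(2) Re_pos[OF qO] by auto
      next
        case 2
        then have "p q = p q'"
          using on_axis_u[of "p q" q'] on_axis_v[of "p q" q'] q(2) Re_pos[OF qO] by auto
        then show ?thesis
          using eqp 2 by blast
      next
        case 3
        then show ?thesis
          using seg_ab[of "p q"] q(2) g_1[OF qO] Re_pos[OF qO] by auto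
      next
        case 4
        then show ?thesis
          using seg_bc[of "p q"] q(2) g_2[OF qO] Re_pos[OF qO] by auto
      qed
    qed
  qed
  have meet: "z \<in> p ` (e \<inter> e')" if e: "e \<in> edges ?G" "e' \<in> edges ?G" "e \<noteq> e'"
    and z: "z \<in> path_image (\<gamma> e)" "z \<in> path_image (\<gamma> e')" for e e' z
  proof -
    \<comment> \<open>Numbering the five kinds of edges allows the pair to be ordered by kind, which
      halves the case analysis.\<close>
    define k where "k e = (if e = {u, v} then 0 else if \<exists>q\<in>?O. e = {u, q} then 1
      else if \<exists>q\<in>?O. e = {v, q} then 2 else if e = {a, b} then 3 else (4::nat))" for e
    have k: "k e = 0 \<Longrightarrow> e = {u, v}" "k e = 1 \<Longrightarrow> \<exists>q\<in>?O. e = {u, q}" "k e = 2 \<Longrightarrow> \<exists>q\<in>?O. e = {v, q}"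
      "k e = 3 \<Longrightarrow> e = {a, b}" "k e = 4 \<Longrightarrow> e \<in> edges ?G \<Longrightarrow> e = {b, c}" "k e \<le> 4" for e
      using edge_cases[of e] unfolding k_def by (auto split: if_splits)
    have main: "z \<in> p ` (e \<inter> e')" if "k e \<le> k e'" "e \<noteq> e'" "z \<in> path_image (\<gamma> e)" "z \<in> path_image (\<gamma> e')"
      "e \<in> edges ?G" "e' \<in> edges ?G" for e e'
    proof -
      note le = that(1) and zz = that(3,4) and ee = that(5,6)
      have "k e = 0 \<or> k e = 1 \<or> k e = 2 \<or> k e = 3 \<or> k e = 4"
        using k(6)[of e] by linarith
      moreover have "k e' = 0 \<or> k e' = 1 \<or> k e' = 2 \<or> k e' = 3 \<or> k e' = 4"
        using k(6)[of e'] by linarith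
      ultimately consider "k e = 0" "k e' = 1" | "k e = 0" "k e' = 2" | "k e = 0" "k e' \<ge> 3"
        | "k e = 1" "k e' = 1" | "k e = 1" "k e' = 2" | "k e = 1" "k e' = 3" | "k e = 1" "k e' = 4"
        | "k e = 2" "k e' = 2" | "k e = 2" "k e' = 3" | "k e = 2" "k e' = 4"
        | "k e = 3" "k e' = 4" | "k e = k e'" "k e \<in> {0, 3, 4}"
        using le by auto
      then show ?thesis
      proof cases
        case 1
        obtain q where "q \<in> ?O" "e = {u, v}" "e' = {u, q}" using k(1)[OF 1(1)] k(2)[OF 1(2)] by blast
        then show ?thesis using hub_u[of z q] seg_uv[of z] zz by auto
      next
        case 2
        obtain q where "q \<in> ?O" "e = {u, v}" "e' = {v, q}" using k(1)[OF 2(1)] k(3)[OF 2(2)] by blast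
        then show ?thesis using hub_v[of z q] seg_uv[of z] zz by auto
      next
        case 3
        then have "k e' = 3 \<or> k e' = 4" using k(6)[of e'] by linarith
        then have "e' = {a, b} \<or> e' = {b, c}" "e = {u, v}"
          using k(4,5)[of e'] k(1)[OF 3(1)] ee(2) by auto
        then show ?thesis using seg_uv[of z] seg_ab[of z] seg_bc[of z] zz by auto
      next
        case 4
        obtain q q' where "q \<in> ?O" "q' \<in> ?O" "e = {u, q}" "e' = {u, q'}" using k(2)[OF 4(1)] k(2)[OF 4(2)] by blast
        then show ?thesis using two_u[of z q q'] zz that(2) by auto
      next
        case 5
        obtain q q' where "q \<in> ?O" "q' \<in> ?O" "e = {u, q}" "e' = {v, q'}" using k(2)[OF 5(1)] k(3)[OF 5(2)] by blast
        then show ?thesis using u_v[of z q q'] zz by auto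
      next
        case 6
        obtain q where "q \<in> ?O" "e = {u, q}" "e' = {a, b}" using k(2)[OF 6(1)] k(4)[OF 6(2)] by blast
        then show ?thesis using hub_ab[of z u q] zz by auto
      next
        case 7
        obtain q where "q \<in> ?O" "e = {u, q}" "e' = {b, c}" using k(2)[OF 7(1)] k(5)[OF 7(2) ee(2)] by blast
        then show ?thesis using hub_bc[of z u q] zz by auto
      next
        case 8
        obtain q q' where "q \<in> ?O" "q' \<in> ?O" "e = {v, q}" "e' = {v, q'}" using k(3)[OF 8(1)] k(3)[OF 8(2)] by blast
        then show ?thesis using two_v[of z q q'] zz that(2) by auto
      next
        case 9
        obtain q where "q \<in> ?O" "e = {v, q}" "e' = {a, b}" using k(3)[OF 9(1)] k(4)[OF 9(2)] by blast
        then show ?thesis using hub_ab[of z v q] zz by auto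
      next
        case 10
        obtain q where "q \<in> ?O" "e = {v, q}" "e' = {b, c}" using k(3)[OF 10(1)] k(5)[OF 10(2) ee(2)] by blast
        then show ?thesis using hub_bc[of z v q] zz by auto
      next
        case 11
        have "e = {a, b}" "e' = {b, c}" using k(4)[OF 11(1)] k(5)[OF 11(2) ee(2)] by simp_all
        then show ?thesis using ab_bc[of z] zz by auto
      next
        case 12
        then have "e = e'"
          using k(1,4,5)[of e] k(1,4,5)[of e'] ee by auto
        then show ?thesis using that(2) by simp
      qed
    qed
    show ?thesis
    proof (cases "k e \<le> k e'")
      case True
      then show ?thesis using main[of e e'] e z by blast
    next
      case False
      then show ?thesis using main[of e' e] e z by (simp add: Int_commute)
    qed
  qed
  have "planar_drawing ?G p \<gamma>"
    unfolding planar_drawing_def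
  proof (intro conjI ballI impI subsetI)
    show "inj_on p (pverts ?G)"
      using inj by simp
    fix e assume e: "e \<in> edges ?G"
    obtain i j where ij: "i \<in> V" "j \<in> V" "i \<noteq> j" "e = {i, j}"
      using edge_ij[OF e] by blast
    have se: "{fst (s e), snd (s e)} = e"
      using s[OF ij(4)] .
    then have "fst (s e) \<in> V" "snd (s e) \<in> V" "fst (s e) \<noteq> snd (s e)"
      using ij by (auto simp: doubleton_eq_iff)
    then have "p (fst (s e)) \<noteq> p (snd (s e))"
      using inj by (auto dest: inj_onD)
    then show "arc (\<gamma> e)"
      unfolding \<gamma>_def by (rule arc_linepath)
    show ends: "{pathstart (\<gamma> e), pathfinish (\<gamma> e)} = p ` e"
      using se unfolding \<gamma>_def by (metis image_empty image_insert pathfinish_linepath pathstart_linepath)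
    have "p ` e \<subseteq> path_image (\<gamma> e)"
      unfolding ends[symmetric] using pathstart_in_path_image pathfinish_in_path_image by blast
    then show "path_image (\<gamma> e) \<inter> p ` pverts ?G = p ` e"
      using vert[OF e] ij by auto
  next
    fix e e' z
    assume "e \<in> edges ?G" "e' \<in> edges ?G" "e \<noteq> e'" "z \<in> path_image (\<gamma> e) \<inter> path_image (\<gamma> e')"
    then show "z \<in> p ` (e \<inter> e')"
      using meet by blast
  qed
  then show ?thesis
    unfolding planar_def by blast
qed

section \<open>Uniqueness of the extremal graph\<close>

lemma planar_free_k2p3:
  assumes "finite V" "distinct [u, v, a, b, c]" "{u, v, a, b, c} \<subseteq> V"
  shows "planar_free_graph (card V) two_cycles \<lparr>pverts = V, parcs = k2p3_arcs V u v a b c\<rparr>"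
proof -
  have G: "pair_graph \<lparr>pverts = V, parcs = k2p3_arcs V u v a b c\<rparr>"
    by (rule sgraph_pair_graph[OF sgraph_k2p3[OF assms(1)]])
  moreover have "family_free two_cycles \<lparr>pverts = V, parcs = k2p3_arcs V u v a b c\<rparr>"
    unfolding two_cycles_free_iff[OF G] using k2p3_no_disjoint_cores[OF assms(1,2)] by simp
  ultimately show ?thesis
    unfolding planar_free_graph_def using planar_k2p3[OF assms] by simp
qed

lemma planar_free_cgraph:
  fixes G :: "'a pair_pre_digraph"
  assumes "planar_free_graph n two_cycles G"
  shows "cgraph (pverts G) (parcs G)"
proof -
  have G: "pair_graph G" "planar G" "family_free two_cycles G"
    using assms unfolding planar_free_graph_def by auto
  interpret sgraph "pverts G" "parcs G"
    by (rule pair_graph_sgraph[OF G(1)])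
  show ?thesis
  proof
    show "S \<inter> S' \<noteq> {}" if "core S" "core S'" for S S'
      using G(3) that unfolding two_cycles_free_iff[OF G(1)] by blast
    fix a b c :: 'a assume dist: "distinct [a, b, c]"
    let ?N = "parcs G `` {a} \<inter> parcs G `` {b} \<inter> parcs G `` {c}"
    show "card ?N \<le> 2"
    proof (rule ccontr)
      assume "\<not> card ?N \<le> 2"
      then have "3 \<le> card ?N"
        by simp
      then obtain T where T: "T \<subseteq> ?N" "card T = 3"
        by (meson obtain_subset_with_card_n)
      then obtain d e f where def: "T = {d, e, f}" "d \<noteq> e" "e \<noteq> f" "d \<noteq> f"
        by (auto simp: card_3_iff)
      have sub: "{a, b, c} \<times> {d, e, f} \<subseteq> parcs G"
        using T(1) def(1) by auto
      have ne: "x \<noteq> y" if "x \<in> {a, b, c}" "y \<in> {d, e, f}" for x y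
        using sub that E_irrefl by blast
      have "a \<noteq> d" "a \<noteq> e" "a \<noteq> f" "b \<noteq> d" "b \<noteq> e" "b \<noteq> f" "c \<noteq> d" "c \<noteq> e" "c \<noteq> f"
        by (rule ne; simp)+
      then have "distinct [a, b, c, d, e, f]"
        using dist def(2-4) by simp
      then show False
        by (rule planar_no_K33[OF G(1,2) _ sub])
    qed
  qed
qed

text \<open>A reference copy over the type on which \<open>spex_planar\<close> takes its maximum;
  graphs over other vertex types are compared with it.\<close>

definition k2p3_nat :: "nat \<Rightarrow> nat pair_pre_digraph" where
  "k2p3_nat n = \<lparr>pverts = {..<n}, parcs = k2p3_arcs {..<n} 0 1 2 3 4\<rparr>"

lemma k2p3_nat:
  assumes "5 \<le> n"
  shows "pair_graph (k2p3_nat n)" "pverts (k2p3_nat n) \<noteq> {}"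
    "planar_free_graph n two_cycles (k2p3_nat n)"
    "sqrt (2 * real n - 4) \<le> graph_spectral_radius (k2p3_nat n)"
    "\<And>(V :: 'b set) u v a b c. finite V \<Longrightarrow> distinct [u, v, a, b, c] \<Longrightarrow> {u, v, a, b, c} \<subseteq> V \<Longrightarrow> card V = n \<Longrightarrow>
      graph_iso \<lparr>pverts = V, parcs = k2p3_arcs V u v a b c\<rparr> (k2p3_nat n)"
proof -
  have *: "finite {..<n}" "distinct [0, 1, 2, 3, 4 :: nat]" "{0, 1, 2, 3, 4} \<subseteq> {..<n}"
    using assms by auto
  show "pair_graph (k2p3_nat n)"
    unfolding k2p3_nat_def by (rule sgraph_pair_graph[OF sgraph_k2p3[OF *(1)]])
  show "pverts (k2p3_nat n) \<noteq> {}"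
    using assms by (auto simp: k2p3_nat_def lessThan_empty_iff)
  show "planar_free_graph n two_cycles (k2p3_nat n)"
    using planar_free_k2p3[OF *] by (simp add: k2p3_nat_def)
  show "sqrt (2 * real n - 4) \<le> graph_spectral_radius (k2p3_nat n)"
    using k2p3_spectral_radius_ge[OF *] by (simp add: k2p3_nat_def)
  show "graph_iso \<lparr>pverts = V, parcs = k2p3_arcs V u v a b c\<rparr> (k2p3_nat n)"
    if "finite V" "distinct [u, v, a, b, c]" "{u, v, a, b, c} \<subseteq> V" "card V = n" for V :: "'b set" and u v a b c
    unfolding k2p3_nat_def using that by (intro k2p3_iso *) simp_all
qed

text \<open>The comparison \<open>le\<close> is not strict, so the lemma serves twice: to show that
  no graph exceeds the reference copy, and to show that every graph reaching its value is isomorphic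
  to it.\<close>

lemma spectral_maximum_iso:
  assumes n: "real n \<ge> 2 * 10 ^ 17" and G: "planar_free_graph n two_cycles G"
    and le: "graph_spectral_radius (k2p3_nat n) \<le> graph_spectral_radius G"
  obtains u v a b c where "distinct [u, v, a, b, c]" "{u, v, a, b, c} \<subseteq> pverts G"
    "parcs G = k2p3_arcs (pverts G) u v a b c" "graph_iso G (k2p3_nat n)"
proof -
  let ?r = "graph_spectral_radius G"
  have "5 \<le> real n"
    using n by simp
  then have n5: "5 \<le> n"
    by simp
  have pg: "pair_graph G" and card: "card (pverts G) = n"
    using G unfolding planar_free_graph_def by auto
  have ne: "pverts G \<noteq> {}"
    using card n5 by auto
  interpret cgraph "pverts G" "parcs G"
    by (rule planar_free_cgraph[OF G])
  obtain y where y: "\<And>v. y v \<ge> (0::real)" "sq y = 1"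
    "\<And>v. v \<in> pverts G \<Longrightarrow> (\<Sum>w\<in>parcs G `` {v}. y w) = ?r * y v"
    by (rule spectral_radius_rayleigh[OF pg ne]) (rule that; assumption)
  define M where "M = Max (y ` pverts G)"
  have M_ge: "y v \<le> M" if "v \<in> pverts G" for v
    unfolding M_def using that by simp
  have "M \<in> y ` pverts G"
    unfolding M_def using ne by (intro Max_in) auto
  then obtain z where z: "z \<in> pverts G" "y z = M"
    by auto
  have "M \<noteq> 0"
  proof
    assume "M = 0"
    then have "y v = 0" if "v \<in> pverts G" for v
      using M_ge[OF that] y(1)[of v] by simp
    then have "sq y = 0"
      unfolding sq_def by simp
    with y(2) show False
      by simp
  qed
  then have M: "M > 0"
    using y(1)[of z] z(2) by simp
  \<comment> \<open>The vector \<open>y\<close> has Euclidean norm 1; the estimates need maximum 1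
    instead.\<close>
  define x where "x v = y v / M" for v
  have r: "sqrt (2 * real n - 4) \<le> ?r"
    using k2p3_nat(4)[OF n5] le by simp
  have pos: "0 \<le> 2 * real n - 4"
    using n by simp
  interpret cgraph_eig "pverts G" "parcs G" x ?r z
  proof
    show "2 * 10 ^ 17 \<le> real (card (pverts G))"
      using n card by simp
    show "0 \<le> x v" for v
      unfolding x_def using M y(1) by simp
    show "x v \<le> 1" if "v \<in> pverts G" for v
      unfolding x_def using M M_ge[OF that] by simp
    show "z \<in> pverts G" "x z = 1"
      unfolding x_def using z M by auto
    show "(\<Sum>w\<in>parcs G `` {v}. x w) = ?r * x v" if "v \<in> pverts G" for v
      unfolding x_def sum_divide_distrib[symmetric] using y(3)[OF that] by simp
    show "0 \<le> ?r"
      using r real_sqrt_ge_zero[OF pos] by linarith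
    have "(sqrt (2 * real n - 4))\<^sup>2 \<le> ?r\<^sup>2"
      using r real_sqrt_ge_zero[OF pos] by (rule power_mono)
    then show "2 * real (card (pverts G)) - 4 \<le> ?r\<^sup>2"
      using pos card by simp
  qed
  have "sgraph.qf (k2p3_arcs (pverts G) u v a b c) w \<le> graph_spectral_radius (k2p3_nat n) * sq w"
    if d: "distinct [u, v, a, b, c]" "{u, v, a, b, c} \<subseteq> pverts G" for u v a b c w
  proof -
    let ?H = "\<lparr>pverts = pverts G, parcs = k2p3_arcs (pverts G) u v a b c\<rparr>"
    have H: "pair_graph ?H" "pverts ?H \<noteq> {}"
      using sgraph_pair_graph[OF sgraph_k2p3[OF fin_V]] ne by auto
    have "sgraph.qf (parcs ?H) w \<le> graph_spectral_radius ?H * sgraph.sq (pverts ?H) w"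
      by (rule spectral_radius_rayleigh[OF H])
    moreover have "graph_spectral_radius ?H = graph_spectral_radius (k2p3_nat n)"
      by (rule graph_iso_spectral_radius[OF H(1) k2p3_nat(1)[OF n5] H(2)
        k2p3_nat(5)[OF n5 fin_V d card]])
    ultimately show ?thesis
      by simp
  qed
  then obtain u v a b c where *: "distinct [u, v, a, b, c]" "{u, v, a, b, c} \<subseteq> pverts G"
    "parcs G = k2p3_arcs (pverts G) u v a b c"
    by (rule unique_maximum[OF _ le])
  have "graph_iso \<lparr>pverts = pverts G, parcs = k2p3_arcs (pverts G) u v a b c\<rparr> (k2p3_nat n)"
    by (rule k2p3_nat(5)[OF n5 fin_V *(1,2) card])
  moreover have "\<lparr>pverts = pverts G, parcs = k2p3_arcs (pverts G) u v a b c\<rparr> = G"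
    unfolding *(3)[symmetric] by simp
  ultimately have "graph_iso G (k2p3_nat n)"
    by simp
  with * show thesis
    by (rule that)
qed

text \<open>Makes the \<open>Max\<close> in \<open>spex_planar\<close> meaningful: infinitely many
  graphs compete, but the radius is invariant under isomorphism and each of them can be moved to
  \<open>{..<n}\<close>.\<close>

lemma finite_spectral_radii:
  "finite {graph_spectral_radius G | G :: nat pair_pre_digraph. planar_free_graph n \<F> G}"
\<comment> \<open>Invariance of the radius is available only for nonempty graphs; for
  \<open>n = 0\<close> there is a single graph anyway.\<close>
proof (cases "n = 0")
  case True
  have "G = \<lparr>pverts = {}, parcs = {}\<rparr>" if "planar_free_graph n \<F> G" for G :: "nat pair_pre_digraph"
  proof -
    have "pair_graph G" "card (pverts G) = 0"
      using that True unfolding planar_free_graph_def by auto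
    then interpret sgraph "pverts G" "parcs G"
      using pair_graph_sgraph by blast
    have "pverts G = {}"
      using \<open>card (pverts G) = 0\<close> by simp
    then show ?thesis
      using E_sub by simp
  qed
  then have "{graph_spectral_radius G | G :: nat pair_pre_digraph. planar_free_graph n \<F> G}
      \<subseteq> {graph_spectral_radius \<lparr>pverts = {}, parcs = {} :: (nat \<times> nat) set\<rparr>}"
    by blast
  then show ?thesis
    by (rule finite_subset) simp
next
  case False
  let ?A = "(\<lambda>E. graph_spectral_radius \<lparr>pverts = {..<n}, parcs = E\<rparr>) ` Pow ({..<n} \<times> {..<n})"
  have "graph_spectral_radius G \<in> ?A" if "planar_free_graph n \<F> G" for G :: "nat pair_pre_digraph"
  proof -
    have pg: "pair_graph G" and card: "card (pverts G) = n"
      using that unfolding planar_free_graph_def by auto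
    interpret sgraph "pverts G" "parcs G"
      by (rule pair_graph_sgraph[OF pg])
    obtain f where f: "bij_betw f (pverts G) {..<n}"
      using finite_same_card_bij[of "pverts G" "{..<n}"] card by auto
    then have inj: "inj_on f (pverts G)" and im: "f ` pverts G = {..<n}"
      by (auto simp: bij_betw_def)
    define E where "E = map_prod f f ` parcs G"
    have sub: "E \<subseteq> {..<n} \<times> {..<n}"
      unfolding E_def im[symmetric] using E_sub by auto
    have iso: "graph_iso G \<lparr>pverts = {..<n}, parcs = E\<rparr>"
      by (rule graph_isoI[OF pg inj]) (simp_all add: im E_def)
    have "sgraph {..<n} E"
    proof
      show "E \<subseteq> {..<n} \<times> {..<n}"
        by (rule sub)
      show "(v, u) \<in> E" if "(u, v) \<in> E" for u v
      proof -
        obtain i j where "(i, j) \<in> parcs G" "u = f i" "v = f j"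
          using \<open>(u, v) \<in> E\<close> unfolding E_def by auto
        then show ?thesis
          unfolding E_def using E_sym[of i j] by (intro image_eqI[of _ _ "(j, i)"]) simp_all
      qed
      show "(u, u) \<notin> E" for u
      proof
        assume "(u, u) \<in> E"
        then obtain i j where ij: "(i, j) \<in> parcs G" "f i = f j"
          unfolding E_def by auto
        then have "i = j"
          using inj_onD[OF inj ij(2)] E_V by blast
        with ij(1) show False
          by simp
      qed
    qed simp
    then have "pair_graph \<lparr>pverts = {..<n}, parcs = E\<rparr>"
      by (rule sgraph_pair_graph)
    moreover have "pverts G \<noteq> {}"
      using card False by auto
    ultimately have "graph_spectral_radius G = graph_spectral_radius \<lparr>pverts = {..<n}, parcs = E\<rparr>"
      using iso by (intro graph_iso_spectral_radius pg)
    then show ?thesis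
      using sub by blast
  qed
  then have "{graph_spectral_radius G | G :: nat pair_pre_digraph. planar_free_graph n \<F> G} \<subseteq> ?A"
    by blast
  then show ?thesis
    by (rule finite_subset) simp
qed

text \<open>A graph with a larger radius would be isomorphic to the reference copy and hence have
  the same radius.\<close>

lemma spex_planar_k2p3:
  assumes n: "real n \<ge> 2 * 10 ^ 17"
  shows "spex_planar n two_cycles = graph_spectral_radius (k2p3_nat n)"
  unfolding spex_planar_def
proof (rule Max_eqI[OF finite_spectral_radii])
  have "5 \<le> real n"
    using n by simp
  then have n5: "5 \<le> n"
    by simp
  show "graph_spectral_radius (k2p3_nat n)
      \<in> {graph_spectral_radius G | G :: nat pair_pre_digraph. planar_free_graph n two_cycles G}"
    using k2p3_nat(3)[OF n5] by blast
  fix r assume "r \<in> {graph_spectral_radius G | G :: nat pair_pre_digraph. planar_free_graph n two_cycles G}"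
  then obtain G :: "nat pair_pre_digraph" where G: "planar_free_graph n two_cycles G" "r = graph_spectral_radius G"
    by blast
  show "r \<le> graph_spectral_radius (k2p3_nat n)"
  proof (rule ccontr)
    assume gt: "\<not> ?thesis"
    then have "graph_spectral_radius (k2p3_nat n) \<le> graph_spectral_radius G"
      using G(2) by simp
    then have iso: "graph_iso G (k2p3_nat n)"
      by (rule spectral_maximum_iso[OF n G(1)])
    have pg: "pair_graph G" and card: "card (pverts G) = n"
      using G(1) unfolding planar_free_graph_def by auto
    have "pverts G \<noteq> {}"
      using card n5 by auto
    then show False
      using graph_iso_spectral_radius[OF pg k2p3_nat(1)[OF n5] _ iso] gt G(2) by simp
  qed
qed

text \<open>An equality rather than an isomorphism: the hubs are the \<open>Inl\<close> vertices of
  the join, and the path consists of \<open>Inr (Inl 0)\<close>, \<open>Inr (Inl 1)\<close>,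
  \<open>Inr (Inl 2)\<close>. The truncated difference \<open>n - 5\<close> gives n vertices in
  total only for \<open>n >= 5\<close>.\<close>

lemma join_eq_k2p3:
  assumes "5 \<le> n"
  defines "V \<equiv> pverts (graph_join (complete_graph 2) (H31 n))"
  shows "graph_join (complete_graph 2) (H31 n)
      = \<lparr>pverts = V, parcs = k2p3_arcs V (Inl 0) (Inl 1) (Inr (Inl 0)) (Inr (Inl 1)) (Inr (Inl 2))\<rparr>"
    and "finite V" "card V = n" "{Inl 0, Inl 1, Inr (Inl 0), Inr (Inl 1), Inr (Inl 2)} \<subseteq> V"
proof -
  have V: "V = {..<2} <+> ({..<3} <+> {..<n - 5})"
    unfolding V_def by (simp add: graph_join_def complete_graph_def H31_def disjoint_union_def
      path_graph_def empty_graph_def)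
  show "finite V" "card V = n" "{Inl 0, Inl 1, Inr (Inl 0), Inr (Inl 1), Inr (Inl 2)} \<subseteq> V"
    unfolding V using assms(1) by (auto simp: card_Plus)
  have three: "i < 3 \<longleftrightarrow> i = 0 \<or> i = 1 \<or> i = 2" for i :: nat
    by auto
  have two: "i < 2 \<longleftrightarrow> i = 0 \<or> i = 1" for i :: nat
    by auto
  have "e \<in> parcs (graph_join (complete_graph 2) (H31 n)) \<longleftrightarrow>
      e \<in> k2p3_arcs V (Inl 0) (Inl 1) (Inr (Inl 0)) (Inr (Inl 1)) (Inr (Inl 2))" for e
  proof -
    obtain p q where e: "e = (p, q)"
      by fastforce
    show ?thesis
      unfolding e V
      by (cases p; cases q; (cases "projr p")?; (cases "projr q")?)
        (auto simp: graph_join_def complete_graph_def H31_def disjoint_union_def path_graph_def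
          empty_graph_def k2p3_arcs_def three two doubleton_eq_iff map_prod_def split_def image_iff)
  qed
  then have "parcs (graph_join (complete_graph 2) (H31 n))
      = k2p3_arcs V (Inl 0) (Inl 1) (Inr (Inl 0)) (Inr (Inl 1)) (Inr (Inl 2))"
    by blast
  then show "graph_join (complete_graph 2) (H31 n)
      = \<lparr>pverts = V, parcs = k2p3_arcs V (Inl 0) (Inl 1) (Inr (Inl 0)) (Inr (Inl 1)) (Inr (Inl 2))\<rparr>"
    unfolding V_def by (simp add: pair_pre_digraph.equality)
qed

theorem corollary1p1:
  fixes n :: nat
  assumes "real n \<ge> 2.16 * 10 ^ 17"
  shows "extremal_planar n two_cycles (graph_join (complete_graph 2) (H31 n)) \<and>
    (\<forall>G :: 'a pair_pre_digraph.
      extremal_planar n two_cycles G \<longrightarrow> graph_iso G (graph_join (complete_graph 2) (H31 n)))"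
proof -
  have n: "real n \<ge> 2 * 10 ^ 17"
    using assms by simp
  then have "5 \<le> real n"
    by simp
  then have n5: "5 \<le> n"
    by simp
  let ?J = "graph_join (complete_graph 2) (H31 n)"
  note J = join_eq_k2p3[OF n5]
  have d: "distinct [Inl 0, Inl 1, Inr (Inl 0), Inr (Inl 1), Inr (Inl 2) :: nat + nat + nat]"
    by simp
  have free: "planar_free_graph n two_cycles ?J"
    using planar_free_k2p3[OF J(2) d J(4)] unfolding J(1)[symmetric] J(3) .
  then have pg: "pair_graph ?J"
    unfolding planar_free_graph_def by blast
  have iso: "graph_iso ?J (k2p3_nat n)"
    using k2p3_nat(5)[OF n5 J(2) d J(4) J(3)] unfolding J(1)[symmetric] .
  have "pverts ?J \<noteq> {}"
    using J(4) by blast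
  then have "graph_spectral_radius ?J = graph_spectral_radius (k2p3_nat n)"
    by (rule graph_iso_spectral_radius[OF pg k2p3_nat(1)[OF n5] _ iso])
  then have "extremal_planar n two_cycles ?J"
    unfolding extremal_planar_def spex_planar_k2p3[OF n] using free by blast
  moreover have "graph_iso G ?J" if G: "extremal_planar n two_cycles G" for G :: "'a pair_pre_digraph"
  proof -
    have "planar_free_graph n two_cycles G" "graph_spectral_radius (k2p3_nat n) \<le> graph_spectral_radius G"
      using G unfolding extremal_planar_def spex_planar_k2p3[OF n] by auto
    then have "graph_iso G (k2p3_nat n)"
      by (rule spectral_maximum_iso[OF n])
    moreover have "graph_iso (k2p3_nat n) ?J"
      by (rule graph_iso_sym[OF pg iso])
    ultimately show ?thesis
      by (rule graph_iso_trans)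
  qed
  ultimately show ?thesis
    by blast
qed

end
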